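(* Let Assumption 1 (stated in the context) hold, let $F$ be convex, and let $x^*$ be an optimal solution of $\min_{x\in\mathcal X}F(x)$, $F^*=F(x^* )$. Let $D_x>0$ be such that $\sup_{x\in\mathcal X}\|x-x^*\|^2\le D_x$. Let $\{(x_k,y_k)\}$ be generated by the basic SCGD algorithm (defined in the context) with stepsizes $\alpha_k=k^{-a}$, $\beta_k=k^{-b}$ for $k\ge1$ (and $\alpha_0,\beta_0\in(0,1]$ arbitrary), where $a,b\in(0,1)$, and let $D_y>0$ be a scalar such that $\mathbf E[\|y_{k+1}-g(x_k)\|^2]\le D_y$ for all $k\ge 0$. Let $\widehat x_k=\frac1{N_k}\sum_{t=k-N_k+1}^{k}x_t$ with $N_k=\lceil k/2\rceil$, $k\ge1$. Then $$\mathbf E[F(\widehat x_k)-F^*]=\mathcal O\Big((1+L_f^2C_g^2)(D_x+D_y)(k^{a-1}+k^{b-a})+C_fC_gk^{-a}+V_gk^{a-2b}+C_g^2C_fk^{b-a}\Big).$$ Moreover, for $k$ sufficiently large the order in $k$ of this bound is minimized over $a,b\in(0,1)$ at $a^*=3/4$, $b^*=1/2$, and for this choice, with $D=D_x+D_y$, $$\mathbf E[F(\widehat x_k)-F^*]=\mathcal O\Big(\frac{(1+L_f^2C_g^2)D+V_g+C_g^2C_f}{k^{1/4}}+\frac{C_fC_g}{k^{3/4}}\Big).$$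
   Context: Problem. Minimize $F(x)=f(g(x))$ over $x\in\mathcal X\subset\mathbb R^n$, where $f:\mathbb R^m\to\mathbb R$, $g:\mathbb R^n\to\mathbb R^m$, $f(y)=\mathbf E[f_v(y)]$, $g(x)=\mathbf E[g_w(x)]$ and $(w,v)$ is a pair of (possibly dependent) random variables. $\|\cdot\|$ is the Euclidean norm (operator norm for matrices) and $\Pi_{\mathcal X}$ is Euclidean projection onto $\mathcal X$. $\partial F(x)$ is the subdifferential of $F$ at $x$, equal to $\{\nabla F(x)\}$ when $F$ is differentiable. For each realization $w$ and each $x\in\mathcal X$, $\widetilde\nabla g_w(x)\in\mathbb R^{n\times m}$ is a given random matrix (a noisy generalized gradient of $g$, whose $j$-th column corresponds to the $j$-th component of $g$). For sequences, $a_k=\mathcal O(b_k)$ means there is $c>0$ independent of $k$ with $|a_k|\le c\,|b_k|$ for all $k\ge1$. Assumption 1. There are positive scalars $C_g,C_f,V_g,L_f$ such that: (i) $f$ is continuously differentiable, $g$ is continuous, $\mathcal X$ is nonempty, closed and convex. (ii) $(w_0,v_0),(w_1,v_1),\dots$ are i.i.d. (copies of $(w,v)$), and with probability 1, for all $x\in\mathcal X$, $\mathbf E[g_{w_0}(x)\mid v_0]=g(x)$ and $\mathbf E[\widetilde\nabla g_{w_0}(x)\nabla f_{v_0}(g(x))\mid v_0]\in\partial F(x)$. (iii) $g$ is Lipschitz continuous with parameter $C_g$, and with probability 1, for all $x\in\mathcal X$, $\mathbf E[\|\widetilde\nabla g_{w_0}(x)\|^2\mid v_0]\le C_g$ and $\mathbf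 E[\|g_{w_0}(x)-g(x)\|^2\mid v_0]\le V_g$. (iv) With probability 1, for all $y,\bar y\in\mathbb R^m$, $\mathbf E[\|\nabla f_{v_0}(y)\|^2\mid w_0]\le C_f$ and $\|\nabla f_{v_0}(y)-\nabla f_{v_0}(\bar y)\|\le L_f\|y-\bar y\|$; $f$ likewise has Lipschitz continuous gradient. Basic SCGD algorithm. Given deterministic $x_0\in\mathcal X$, $y_0\in\mathbb R^m$ and stepsizes $\alpha_k,\beta_k\in(0,1]$, for $k=0,1,2,\dots$: $$y_{k+1}=(1-\beta_k)y_k+\beta_k g_{w_k}(x_k),\qquad x_{k+1}=\Pi_{\mathcal X}\big\{x_k-\alpha_k\widetilde\nabla g_{w_k}(x_k)\nabla f_{v_k}(y_{k+1})\big\}.$$ *)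

theory Defs
  imports "HOL-Probability.Probability" "HOL-Library.Landau_Symbols"
begin

definition gradient :: "('a::euclidean_space \<Rightarrow> real) \<Rightarrow> 'a \<Rightarrow> 'a" where
  "gradient h x = (THE D. GDERIV h x :> D)"

definition subdifferential :: "('a::euclidean_space \<Rightarrow> real) \<Rightarrow> 'a \<Rightarrow> 'a set" where
  "subdifferential h x = {s. \<forall>z. h z \<ge> h x + s \<bullet> (z - x)}"

(* The norm of the type real^'m^'n is the Frobenius norm, hence the detour over onorm. *)
definition op_norm :: "real^'m^'n \<Rightarrow> real" where
  "op_norm A = onorm (\<lambda>z. A *v z)"

definition generated_by :: "'a measure \<Rightarrow> 's measure \<Rightarrow> ('a \<Rightarrow> 's) \<Rightarrow> 'a measure" where
  "generated_by M N Z = vimage_algebra (space M) Z N"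

(* Y is a version of E[Z | G]; real_cond_exp is only available for real-valued functions, so
   vectors are treated coordinatewise. *)
definition cond_exp_version ::
  "'a measure \<Rightarrow> 'a measure \<Rightarrow> ('a \<Rightarrow> 'b::euclidean_space) \<Rightarrow> ('a \<Rightarrow> 'b) \<Rightarrow> bool" where
  "cond_exp_version M G Z Y \<longleftrightarrow>
     integrable M Z \<and> Y \<in> borel_measurable G \<and>
     (\<forall>e\<in>Basis. AE \<omega> in M. Y \<omega> \<bullet> e = real_cond_exp M G (\<lambda>\<omega>. Z \<omega> \<bullet> e) \<omega>)"

(* "With probability 1, for all i in I, P i (E[Z i | G])".  A conditional expectation is determined
   only up to a null set depending on i, so for uncountable I the phrase is meaningful only for
   a suitable family of versions. *)
definition AE_cond_exp ::
  "'a measure \<Rightarrow> 'a measure \<Rightarrow> 'i set \<Rightarrow> ('i \<Rightarrow> 'a \<Rightarrow> 'b::euclidean_space) \<Rightarrow>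
   ('i \<Rightarrow> 'b \<Rightarrow> bool) \<Rightarrow> bool" where
  "AE_cond_exp M G I Z P \<longleftrightarrow>
     (\<exists>Y. (\<forall>i\<in>I. cond_exp_version M G (Z i) (Y i)) \<and> (AE \<omega> in M. \<forall>i\<in>I. P i (Y i \<omega>)))"

(* dg s x is the noisy generalized gradient of g for the realization s of w; its values for x
   outside X are irrelevant. The measurability clauses make the iterates random variables. *)
locale scgd_setting = prob_space M
  for M :: "'a measure" and MW :: "'w measure" and MV :: "'v measure"
    and w :: "nat \<Rightarrow> 'a \<Rightarrow> 'w" and v :: "nat \<Rightarrow> 'a \<Rightarrow> 'v"
    and X :: "(real^'n) set"
    and f :: "real^'m \<Rightarrow> real" and g :: "real^'n \<Rightarrow> real^'m"
    and fv :: "'v \<Rightarrow> real^'m \<Rightarrow> real" and gw :: "'w \<Rightarrow> real^'n \<Rightarrow> real^'m"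
    and dg :: "'w \<Rightarrow> real^'n \<Rightarrow> real^'m^'n"
    and Cg Cf Vg Lf :: real +
  assumes meas_gw: "(\<lambda>(s, x). gw s x) \<in> borel_measurable (MW \<Otimes>\<^sub>M borel)"
    and meas_dg: "(\<lambda>(s, x). dg s x) \<in> borel_measurable (MW \<Otimes>\<^sub>M restrict_space borel X)"
    and meas_grad_fv: "(\<lambda>(s, y). gradient (fv s) y) \<in> borel_measurable (MV \<Otimes>\<^sub>M borel)"
    and f_mean: "\<And>y. integrable M (\<lambda>\<omega>. fv (v 0 \<omega>) y)"
                "\<And>y. f y = expectation (\<lambda>\<omega>. fv (v 0 \<omega>) y)"
    and g_mean: "\<And>x. integrable M (\<lambda>\<omega>. gw (w 0 \<omega>) x)"
                "\<And>x. g x = expectation (\<lambda>\<omega>. gw (w 0 \<omega>) x)"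
    and consts_pos: "0 < Cg" "0 < Cf" "0 < Vg" "0 < Lf"
    and f_C1: "\<And>y. GDERIV f y :> gradient f y" "continuous_on UNIV (gradient f)"
    and g_cont: "continuous_on UNIV g"
    and X_nonempty: "X \<noteq> {}" and X_closed: "closed X" and X_convex: "convex X"
    and indep: "indep_vars (\<lambda>_. MW \<Otimes>\<^sub>M MV) (\<lambda>k \<omega>. (w k \<omega>, v k \<omega>)) UNIV"
    and ident: "\<And>k. distr M (MW \<Otimes>\<^sub>M MV) (\<lambda>\<omega>. (w k \<omega>, v k \<omega>))
                    = distr M (MW \<Otimes>\<^sub>M MV) (\<lambda>\<omega>. (w 0 \<omega>, v 0 \<omega>))"
    and gw_unbiased:
      "AE_cond_exp M (generated_by M MV (v 0)) X (\<lambda>x \<omega>. gw (w 0 \<omega>) x) (\<lambda>x e. e = g x)"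
    and grad_unbiased:
      "AE_cond_exp M (generated_by M MV (v 0)) X
         (\<lambda>x \<omega>. dg (w 0 \<omega>) x *v gradient (fv (v 0 \<omega>)) (g x))
         (\<lambda>x e. e \<in> subdifferential (\<lambda>x. f (g x)) x)"
    and g_lipschitz: "Cg-lipschitz_on UNIV g"
    and dg_bound:
      "AE_cond_exp M (generated_by M MV (v 0)) X (\<lambda>x \<omega>. (op_norm (dg (w 0 \<omega>) x))\<^sup>2) (\<lambda>x e. e \<le> Cg)"
    and gw_variance:
      "AE_cond_exp M (generated_by M MV (v 0)) X (\<lambda>x \<omega>. (norm (gw (w 0 \<omega>) x - g x))\<^sup>2) (\<lambda>x e. e \<le> Vg)"
    and grad_fv_bound:
      "AE_cond_exp M (generated_by M MW (w 0)) UNIV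
         (\<lambda>y \<omega>. (norm (gradient (fv (v 0 \<omega>)) y))\<^sup>2) (\<lambda>y e. e \<le> Cf)"
    and fv_differentiable:
      "AE \<omega> in M. \<forall>y. GDERIV (fv (v 0 \<omega>)) y :> gradient (fv (v 0 \<omega>)) y"
    and grad_fv_lipschitz: "AE \<omega> in M. Lf-lipschitz_on UNIV (gradient (fv (v 0 \<omega>)))"
    and grad_f_lipschitz: "Lf-lipschitz_on UNIV (gradient f)"

definition scgd_iterates ::
  "'a measure \<Rightarrow> (nat \<Rightarrow> 'a \<Rightarrow> 'w) \<Rightarrow> (nat \<Rightarrow> 'a \<Rightarrow> 'v) \<Rightarrow> (real^'n) set \<Rightarrow>
   ('v \<Rightarrow> real^'m \<Rightarrow> real) \<Rightarrow> ('w \<Rightarrow> real^'n \<Rightarrow> real^'m) \<Rightarrow> ('w \<Rightarrow> real^'n \<Rightarrow> real^'m^'n) \<Rightarrow>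
   (nat \<Rightarrow> real) \<Rightarrow> (nat \<Rightarrow> real) \<Rightarrow> real^'n \<Rightarrow> real^'m \<Rightarrow>
   (nat \<Rightarrow> 'a \<Rightarrow> real^'n) \<Rightarrow> (nat \<Rightarrow> 'a \<Rightarrow> real^'m) \<Rightarrow> bool" where
  "scgd_iterates M w v X fv gw dg \<alpha> \<beta> x0 y0 x y \<longleftrightarrow>
     (\<forall>\<omega>\<in>space M. x 0 \<omega> = x0 \<and> y 0 \<omega> = y0 \<and>
        (\<forall>k. y (Suc k) \<omega> = (1 - \<beta> k) *\<^sub>R y k \<omega> + \<beta> k *\<^sub>R gw (w k \<omega>) (x k \<omega>) \<and>
             x (Suc k) \<omega> = closest_point X
               (x k \<omega> - \<alpha> k *\<^sub>R (dg (w k \<omega>) (x k \<omega>) *v gradient (fv (v k \<omega>)) (y (Suc k) \<omega>)))))"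

definition window :: "nat \<Rightarrow> nat" where
  "window k = nat \<lceil>real k / 2\<rceil>"

definition averaged_iterate :: "(nat \<Rightarrow> 'a \<Rightarrow> real^'n) \<Rightarrow> nat \<Rightarrow> 'a \<Rightarrow> real^'n" where
  "averaged_iterate x k \<omega> = (1 / real (window k)) *\<^sub>R (\<Sum>t = k - window k + 1..k. x t \<omega>)"

(* Unlike membership in the Landau set O(b), the estimate is required for all k >= 1. *)
definition is_bigO :: "(nat \<Rightarrow> real) \<Rightarrow> (nat \<Rightarrow> real) \<Rightarrow> bool" where
  "is_bigO a b \<longleftrightarrow> (\<exists>c>0. \<forall>k\<ge>1. \<bar>a k\<bar> \<le> c * \<bar>b k\<bar>)"

definition rate_bound ::
  "real \<Rightarrow> real \<Rightarrow> real \<Rightarrow> real \<Rightarrow> real \<Rightarrow> real \<Rightarrow> real \<Rightarrow> real \<Rightarrow> nat \<Rightarrow> real" where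
  "rate_bound Cg Cf Vg Lf Dx Dy a b k =
     (1 + Lf\<^sup>2 * Cg\<^sup>2) * (Dx + Dy) * (real k powr (a - 1) + real k powr (b - a))
     + Cf * Cg * real k powr (- a) + Vg * real k powr (a - 2 * b)
     + Cg\<^sup>2 * Cf * real k powr (b - a)"

end

theory Submission
  imports Defs
begin

text \<open>
  Write \<open>D k = E |x k - x*|^2\<close> and \<open>T k = E |y k - g (x (k - 1))|^2\<close>. Projection is nonexpansive and
  the noisy gradient taken at \<open>g (x k)\<close> is a subgradient in the mean; replacing \<open>y (k + 1)\<close> by \<open>g (x k)\<close>
  costs a term which Young's inequality splits with weight \<open>\<beta> k\<close>. Hence
  \<open>D (k+1) + 2 \<alpha> k E[F (x k) - F*] \<le> D k + O(\<alpha> k^2 / \<beta> k) + \<beta> k T (k+1)\<close>. As the samples of \<open>g\<close> are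
  unbiased, \<open>T (k+1) \<le> (1 - \<beta> k) T k + O(\<alpha> (k-1)^2 / \<beta> k + \<beta> k^2)\<close>. In the sum \<open>D + T\<close> the tracking
  term is absorbed; dividing by \<open>\<alpha> k\<close> and summing by parts over the window bounds the average of
  \<open>E[F (x t) - F*]\<close>, which dominates \<open>E[F (averaged iterate) - F*]\<close> by convexity.

  Matrices are measured in the Frobenius norm, which exceeds the operator norm only by a factor
  that depends on the dimension.
\<close>

text \<open>The obstacle is that the same sample \<open>w k\<close> enters both
  \<open>y (k + 1)\<close> and the noisy gradient of \<open>g\<close>: the search direction is
  biased and its two factors are dependent. Only second moments are available, so Young's inequality
  has to isolate the tracking error and pair the gradient of \<open>g\<close> with the bounded
  distance to the optimum. Its weight \<open>\<beta> k\<close> matches the contraction of the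
  tracking error, which gives up \<open>\<beta> k * T k\<close> per step.

  No conditional expectation along a filtration appears. The state \<open>(x k, y k)\<close> is a
  function of the first \<open>k\<close> samples, so Tonelli's theorem freezes it and every estimate
  reduces to one step from a fixed state with sample 0. Nonnegative integrals allow this before
  integrability is known.

  The O-constant may depend on all parameters, so only powers of \<open>k\<close> count. After
  division by \<open>\<alpha> k\<close>, the two error terms become \<open>k^(b-a)\<close> and
  \<open>k^(a-2b)\<close>; summation by parts gives \<open>k^a\<close>, and the window length turns
  it into \<open>k^(a-1)\<close>.\<close>

section \<open>Frobenius norm versus operator norm\<close>

lemma norm_matrix_vector_mult_le:
  fixes A :: "real^'m^'n"
  shows "norm (A *v z) \<le> norm A * norm z"
proof -
  have "norm (A *v z) \<le> L2_set (\<lambda>i. norm (A $ i) * norm z) UNIV"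
    unfolding norm_vec_def[of "A *v z"]
    by (intro L2_set_mono)
       (auto simp: matrix_vector_mul_component Cauchy_Schwarz_ineq2)
  also have "\<dots> = norm A * norm z"
    by (simp add: L2_set_left_distrib norm_vec_def[of A])
  finally show ?thesis .
qed

text \<open>Testing \<open>A\<close> on its own \<open>i\<close>-th row puts the squared norm of
  that row into component \<open>i\<close>, so the operator norm dominates each of the
  \<open>CARD('n)\<close> rows.\<close>

lemma norm_power2_le_op_norm:
  fixes A :: "real^'m^'n"
  shows "(norm A)\<^sup>2 \<le> real CARD('n) * (op_norm A)\<^sup>2"
proof -
  have row: "norm (A $ i) \<le> op_norm A" for i
  proof (cases "A $ i = 0")
    case True
    then show ?thesis
      by (simp add: op_norm_def onorm_pos_le matrix_vector_mul_bounded_linear)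
  next
    case False
    have "norm (A $ i) * norm (A $ i) = (A *v (A $ i)) $ i"
      by (simp add: matrix_vector_mul_component power2_norm_eq_inner flip: power2_eq_square)
    also have "\<dots> \<le> norm (A *v (A $ i))"
      using component_le_norm_cart abs_le_D1 by blast
    also have "\<dots> \<le> op_norm A * norm (A $ i)"
      unfolding op_norm_def by (intro onorm matrix_vector_mul_bounded_linear)
    finally show ?thesis using False by simp
  qed
  have "(norm A)\<^sup>2 = (\<Sum>i\<in>UNIV. (norm (A $ i))\<^sup>2)"
    by (simp add: norm_vec_def L2_set_def sum_nonneg)
  also have "\<dots> \<le> (\<Sum>i\<in>(UNIV::'n set). (op_norm A)\<^sup>2)"
    by (intro sum_mono power_mono row) auto
  finally show ?thesis by simp
qed

subsection \<open>Conditional expectations\<close>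

context prob_space
begin

lemma subalgebra_generated_by:
  assumes "W \<in> measurable M N"
  shows "subalgebra M (generated_by M N W)"
  unfolding subalgebra_def generated_by_def
  using assms by (simp add: sets_image_in_sets)

lemma sigma_finite_subalgebra_generated_by:
  assumes "W \<in> measurable M N"
  shows "sigma_finite_subalgebra M (generated_by M N W)"
proof -
  interpret finite_measure_subalgebra M "generated_by M N W"
    by unfold_locales (rule subalgebra_generated_by[OF assms])
  show ?thesis by (rule sigma_finite_subalgebra_axioms)
qed

lemma AE_cond_expE:
  assumes "AE_cond_exp M G I Z P" "i \<in> I"
  obtains Y where "cond_exp_version M G (Z i) Y" "AE \<omega> in M. P i (Y \<omega>)"
proof -
  obtain Y where Y: "\<forall>i\<in>I. cond_exp_version M G (Z i) (Y i)" "AE \<omega> in M. \<forall>i\<in>I. P i (Y i \<omega>)"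
    using assms(1) unfolding AE_cond_exp_def by blast
  have "AE \<omega> in M. P i (Y i \<omega>)"
    using Y(2) assms(2) by (auto elim: eventually_mono)
  then show thesis using that Y(1) assms(2) by blast
qed

lemma AE_cond_exp_integrable:
  assumes "AE_cond_exp M G I Z P" "i \<in> I"
  shows "integrable M (Z i)"
  using assms unfolding AE_cond_exp_def cond_exp_version_def by blast

text \<open>The tower property tested against a fixed vector: \<open>u = 1\<close> integrates a
  scalar bound, \<open>u = z - x\<close> a subgradient inequality. Versions are given
  coordinatewise, hence the expansion over \<open>Basis\<close>.\<close>

lemma AE_cond_exp_expectation_le:
  assumes sub: "sigma_finite_subalgebra M G"
    and Z: "AE_cond_exp M G I Z P" and i: "i \<in> I"
    and le: "\<And>e. P i e \<Longrightarrow> e \<bullet> u \<le> c"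
  shows "expectation (\<lambda>\<omega>. Z i \<omega> \<bullet> u) \<le> c"
proof -
  interpret sigma_finite_subalgebra M G by fact
  obtain Y where Y: "cond_exp_version M G (Z i) Y" "AE \<omega> in M. P i (Y \<omega>)"
    by (rule AE_cond_expE[OF Z i])
  have int: "integrable M (\<lambda>\<omega>. Z i \<omega> \<bullet> e)" for e
    using AE_cond_exp_integrable[OF Z i] by simp
  have Ym: "Y \<in> borel_measurable M"
    using Y(1) measurable_from_subalg[OF subalg] unfolding cond_exp_version_def by blast
  have ae: "AE \<omega> in M. Y \<omega> \<bullet> e = real_cond_exp M G (\<lambda>\<omega>. Z i \<omega> \<bullet> e) \<omega>" if "e \<in> Basis" for e
    using Y(1) that unfolding cond_exp_version_def by blast
  have intY: "integrable M (\<lambda>\<omega>. Y \<omega> \<bullet> e)" 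
    and eqY: "expectation (\<lambda>\<omega>. Y \<omega> \<bullet> e) = expectation (\<lambda>\<omega>. Z i \<omega> \<bullet> e)"
    if e: "e \<in> Basis" for e
  proof -
    have "integrable M (\<lambda>\<omega>. Y \<omega> \<bullet> e) \<longleftrightarrow> integrable M (real_cond_exp M G (\<lambda>\<omega>. Z i \<omega> \<bullet> e))"
      using Ym ae[OF e] by (intro integrable_cong_AE) auto
    then show "integrable M (\<lambda>\<omega>. Y \<omega> \<bullet> e)"
      using real_cond_exp_int(1)[OF int] by simp
    have "expectation (\<lambda>\<omega>. Y \<omega> \<bullet> e) = expectation (real_cond_exp M G (\<lambda>\<omega>. Z i \<omega> \<bullet> e))"
      using Ym ae[OF e] by (intro integral_cong_AE) auto
    then show "expectation (\<lambda>\<omega>. Y \<omega> \<bullet> e) = expectation (\<lambda>\<omega>. Z i \<omega> \<bullet> e)"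
      using real_cond_exp_int(2)[OF int] by simp
  qed
  have "expectation (\<lambda>\<omega>. Z i \<omega> \<bullet> u) = (\<Sum>e\<in>Basis. expectation (\<lambda>\<omega>. Z i \<omega> \<bullet> e) * (u \<bullet> e))"
    by (subst euclidean_inner) (simp add: int)
  also have "\<dots> = (\<Sum>e\<in>Basis. expectation (\<lambda>\<omega>. Y \<omega> \<bullet> e) * (u \<bullet> e))"
    by (simp add: eqY)
  also have "\<dots> = expectation (\<lambda>\<omega>. Y \<omega> \<bullet> u)"
    by (subst (2) euclidean_inner) (simp add: intY)
  also have "\<dots> \<le> expectation (\<lambda>\<omega>. c)"
  proof (rule integral_mono_AE)
    show "integrable M (\<lambda>\<omega>. Y \<omega> \<bullet> u)"
      by (subst euclidean_inner) (auto intro!: intY)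
    show "AE \<omega> in M. Y \<omega> \<bullet> u \<le> c"
      using Y(2) le by auto
  qed simp
  finally show ?thesis by (simp add: prob_space)
qed

text \<open>Working in \<open>ennreal\<close> admits any nonnegative function of the conditioning
  variable as weight. In the application it is the squared norm of \<open>dg\<close>, cut down to
  level sets.\<close>

lemma AE_cond_exp_nn_integral_le:
  fixes Z :: "'i \<Rightarrow> 'a \<Rightarrow> real"
  assumes W[measurable]: "W \<in> measurable M N"
    and Z: "AE_cond_exp M (generated_by M N W) I Z (\<lambda>i e. e \<le> c)" and i: "i \<in> I"
    and Z_nonneg: "\<And>\<omega>. 0 \<le> Z i \<omega>"
    and h[measurable]: "h \<in> borel_measurable N"
  shows "(\<integral>\<^sup>+\<omega>. h (W \<omega>) * ennreal (Z i \<omega>) \<partial>M) \<le> ennreal c * (\<integral>\<^sup>+\<omega>. h (W \<omega>) \<partial>M)"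
proof -
  let ?G = "generated_by M N W"
  interpret sigma_finite_subalgebra M ?G
    by (rule sigma_finite_subalgebra_generated_by[OF W])
  have Zi: "integrable M (Z i)"
    by (rule AE_cond_exp_integrable[OF Z i])
  then have [measurable]: "Z i \<in> borel_measurable M" by simp
  obtain Y where Y: "cond_exp_version M ?G (Z i) Y" "AE \<omega> in M. Y \<omega> \<le> c"
    by (rule AE_cond_expE[OF Z i])
  have Y': "AE \<omega> in M. Y \<omega> = real_cond_exp M ?G (Z i) \<omega>"
    using Y(1) unfolding cond_exp_version_def by simp
  have eq: "(\<integral>\<^sup>+\<omega>. h' \<omega> * nn_cond_exp M ?G q \<omega> \<partial>M) = (\<integral>\<^sup>+\<omega>. h' \<omega> * q \<omega> \<partial>M)"
    if "h' \<in> borel_measurable ?G" "q \<in> borel_measurable M" for h' q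
    using that by (rule nn_cond_exp_intg)
  \<comment> \<open>\<open>real_cond_exp\<close> is the difference of \<open>enn2real\<close> of the
    conditional expectations of positive and negative part, and \<open>enn2real\<close> sends
    infinity to 0. The bound passes to \<open>?P\<close> only once \<open>?P\<close> is finite and
    the negative part is zero almost everywhere.\<close>
  let ?P = "nn_cond_exp M ?G (\<lambda>\<omega>. ennreal (Z i \<omega>))"
  have "(\<integral>\<^sup>+\<omega>. ?P \<omega> \<partial>M) = (\<integral>\<^sup>+\<omega>. ennreal (Z i \<omega>) \<partial>M)"
    using eq[of "\<lambda>_. 1" "\<lambda>\<omega>. ennreal (Z i \<omega>)"] by simp
  also have "\<dots> < \<infinity>"
    using Zi Z_nonneg by (simp add: nn_integral_eq_integral)
  finally have "AE \<omega> in M. ?P \<omega> \<noteq> \<infinity>"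
    by (intro nn_integral_PInf_AE) auto
  moreover have "AE \<omega> in M. nn_cond_exp M ?G (\<lambda>\<omega>. ennreal (- Z i \<omega>)) \<omega> = 0"
    using eq[of "\<lambda>_. 1" "\<lambda>\<omega>. ennreal (- Z i \<omega>)"] Z_nonneg
    by (simp add: ennreal_neg nn_integral_0_iff_AE)
  ultimately have bound: "AE \<omega> in M. ?P \<omega> \<le> ennreal c"
    using Y(2) Y'
  proof eventually_elim
    case (elim \<omega>)
    then have "enn2real (?P \<omega>) \<le> c" by (simp add: real_cond_exp_def)
    then show ?case using elim(1)
      by (metis ennreal_enn2real ennreal_leI infinity_ennreal_def less_top)
  qed
  have W': "W \<in> measurable ?G N"
    unfolding generated_by_def using measurable_space[OF W]
    by (intro measurable_vimage_algebra1) auto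
  have "(\<integral>\<^sup>+\<omega>. h (W \<omega>) * ennreal (Z i \<omega>) \<partial>M) = (\<integral>\<^sup>+\<omega>. h (W \<omega>) * ?P \<omega> \<partial>M)"
    by (rule eq[symmetric]) (auto intro: measurable_compose[OF W' h])
  also have "\<dots> \<le> (\<integral>\<^sup>+\<omega>. ennreal c * h (W \<omega>) \<partial>M)"
  proof (rule nn_integral_mono_AE)
    show "AE \<omega> in M. h (W \<omega>) * ?P \<omega> \<le> ennreal c * h (W \<omega>)"
      using bound by eventually_elim (simp add: mult.commute[of "h _"] mult_right_mono)
  qed
  also have "\<dots> = ennreal c * (\<integral>\<^sup>+\<omega>. h (W \<omega>) \<partial>M)"
    by (rule nn_integral_cmult) simp
  finally show ?thesis .
qed

text \<open>A bound on the conditional expectation that holds for each index separately extends to an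
  index chosen as a function of the conditioning variable: approximate this function by simple
  functions and apply Fatou's lemma.\<close>

lemma AE_cond_exp_nn_integral_subst_le:
  fixes D :: "'v \<Rightarrow> 'b::euclidean_space \<Rightarrow> 'c::euclidean_space"
  assumes W[measurable]: "W \<in> measurable M N" and V[measurable]: "V \<in> measurable M N'"
    and D[measurable]: "(\<lambda>(s, y). D s y) \<in> borel_measurable (N' \<Otimes>\<^sub>M borel)"
    and bound: "AE_cond_exp M (generated_by M N W) UNIV (\<lambda>y \<omega>. (norm (D (V \<omega>) y))\<^sup>2) (\<lambda>y e. e \<le> c)"
    and cont: "AE \<omega> in M. continuous_on UNIV (D (V \<omega>))"
    and u[measurable]: "u \<in> borel_measurable N" and h[measurable]: "h \<in> borel_measurable N"
  shows "(\<integral>\<^sup>+\<omega>. h (W \<omega>) * ennreal ((norm (D (V \<omega>) (u (W \<omega>))))\<^sup>2) \<partial>M)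
           \<le> ennreal c * (\<integral>\<^sup>+\<omega>. h (W \<omega>) \<partial>M)"
proof -
  obtain U where U: "\<And>i. simple_function N (U i)" "\<And>s. s \<in> space N \<Longrightarrow> (\<lambda>i. U i s) \<longlonglongrightarrow> u s"
    using borel_measurable_implies_sequence_metric[OF u] by metis
  have U_meas[measurable]: "U i \<in> borel_measurable N" for i
    by (rule borel_measurable_simple_function[OF U(1)])
  have D'[measurable]: "(\<lambda>\<omega>. D (V \<omega>) (q \<omega>)) \<in> borel_measurable M"
    if [measurable]: "q \<in> borel_measurable M" for q
    using measurable_compose[of "\<lambda>\<omega>. (V \<omega>, q \<omega>)", OF _ D] by simp
  let ?I = "\<lambda>q. \<integral>\<^sup>+\<omega>. h (W \<omega>) * ennreal ((norm (D (V \<omega>) (q (W \<omega>))))\<^sup>2) \<partial>M"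
  have simple: "?I (U i) \<le> ennreal c * (\<integral>\<^sup>+\<omega>. h (W \<omega>) \<partial>M)" for i
  proof -
    let ?R = "U i ` space N"
    \<comment> \<open>Membership in a level set of \<open>U i\<close> depends on \<open>W\<close>
      alone, so its indicator can join the weight; on that set the index is the constant
      \<open>r\<close>.\<close>
    let ?h = "\<lambda>r s. h s * indicator (U i -` {r} \<inter> space N) s"
    have fin: "finite ?R" using U(1) by (rule simple_functionD)
    have sets[measurable]: "U i -` {r} \<inter> space N \<in> sets N" for r
      using U(1) by (rule simple_functionD)
    have split: "h s * ennreal (q (U i s)) = (\<Sum>r\<in>?R. ?h r s * ennreal (q r))"
      if "s \<in> space N" for s and q :: "'b \<Rightarrow> real"
    proof -
      have "(\<Sum>r\<in>?R. ?h r s * ennreal (q r)) = (\<Sum>r\<in>?R. if r = U i s then h s * ennreal (q r) else 0)"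
        using that by (intro sum.cong) (auto simp: indicator_def)
      then show ?thesis using fin that by simp
    qed
    have "?I (U i) = (\<integral>\<^sup>+\<omega>. (\<Sum>r\<in>?R. ?h r (W \<omega>) * ennreal ((norm (D (V \<omega>) r))\<^sup>2)) \<partial>M)"
      using measurable_space[OF W] by (intro nn_integral_cong split) auto
    also have "\<dots> = (\<Sum>r\<in>?R. \<integral>\<^sup>+\<omega>. ?h r (W \<omega>) * ennreal ((norm (D (V \<omega>) r))\<^sup>2) \<partial>M)"
      by (intro nn_integral_sum) simp
    also have "\<dots> \<le> (\<Sum>r\<in>?R. ennreal c * (\<integral>\<^sup>+\<omega>. ?h r (W \<omega>) \<partial>M))"
      by (intro sum_mono AE_cond_exp_nn_integral_le[OF W bound, of _ "\<lambda>s. h s * indicator _ s"]) auto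
    also have "\<dots> = ennreal c * (\<integral>\<^sup>+\<omega>. (\<Sum>r\<in>?R. ?h r (W \<omega>)) \<partial>M)"
      by (subst nn_integral_sum) (auto simp: sum_distrib_left)
    also have "(\<integral>\<^sup>+\<omega>. (\<Sum>r\<in>?R. ?h r (W \<omega>)) \<partial>M) = (\<integral>\<^sup>+\<omega>. h (W \<omega>) \<partial>M)"
      using split[of _ "\<lambda>_. 1"] measurable_space[OF W] by (intro nn_integral_cong) simp
    finally show ?thesis .
  qed
  have "?I u \<le> (\<integral>\<^sup>+\<omega>. liminf (\<lambda>i. h (W \<omega>) * ennreal ((norm (D (V \<omega>) (U i (W \<omega>))))\<^sup>2)) \<partial>M)"
  proof (rule nn_integral_mono_AE)
    show "AE \<omega> in M. h (W \<omega>) * ennreal ((norm (D (V \<omega>) (u (W \<omega>))))\<^sup>2)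
        \<le> liminf (\<lambda>i. h (W \<omega>) * ennreal ((norm (D (V \<omega>) (U i (W \<omega>))))\<^sup>2))"
      using cont AE_space
    proof eventually_elim
      case (elim \<omega>)
      let ?q = "\<lambda>i. ennreal ((norm (D (V \<omega>) (U i (W \<omega>))))\<^sup>2)"
      have "(\<lambda>i. U i (W \<omega>)) \<longlonglongrightarrow> u (W \<omega>)"
        using U(2) measurable_space[OF W elim(2)] by blast
      then have "(\<lambda>i. D (V \<omega>) (U i (W \<omega>))) \<longlonglongrightarrow> D (V \<omega>) (u (W \<omega>))"
        using elim(1) by (intro continuous_on_tendsto_compose[OF elim(1)]) auto
      then have lim: "?q \<longlonglongrightarrow> ennreal ((norm (D (V \<omega>) (u (W \<omega>))))\<^sup>2)"
        by (intro tendsto_intros)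
      \<comment> \<open>\<open>h\<close> may be infinite, and multiplication in
        \<open>ennreal\<close> is discontinuous at infinity times 0. If the limit is 0, so is the
        left-hand side.\<close>
      show ?case
      proof (cases "ennreal ((norm (D (V \<omega>) (u (W \<omega>))))\<^sup>2) = 0")
        case False
        then have "(\<lambda>i. h (W \<omega>) * ?q i) \<longlonglongrightarrow> h (W \<omega>) * ennreal ((norm (D (V \<omega>) (u (W \<omega>))))\<^sup>2)"
          using lim by (intro tendsto_mult_ennreal) auto
        then show ?thesis by (simp add: lim_imp_Liminf)
      qed simp
    qed
  qed
  also have "\<dots> \<le> liminf (\<lambda>i. ?I (U i))"
    by (rule nn_integral_liminf) simp
  also have "\<dots> \<le> ennreal c * (\<integral>\<^sup>+\<omega>. h (W \<omega>) \<partial>M)"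
    using simple by (intro Liminf_le) (auto simp: eventually_sequentially)
  finally show ?thesis .
qed

end

subsection \<open>One step from a fixed state\<close>

lemma nonneg_integral_le_of_nn_integral_le:
  fixes q :: "'a \<Rightarrow> real"
  assumes [measurable]: "q \<in> borel_measurable N" and nonneg: "\<And>z. 0 \<le> q z" and "0 \<le> c"
    and le: "(\<integral>\<^sup>+z. ennreal (q z) \<partial>N) \<le> ennreal c"
  shows "integrable N q" and "integral\<^sup>L N q \<le> c"
proof -
  have "(\<integral>\<^sup>+z. ennreal (q z) \<partial>N) < \<infinity>"
    using le ennreal_less_top order_le_less_trans by fastforce
  then show int: "integrable N q"
    using nonneg by (intro integrableI_nonneg) auto
  then show "integral\<^sup>L N q \<le> c"
    using nn_integral_eq_integral[OF int] nonneg le \<open>0 \<le> c\<close> by simp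
qed

context scgd_setting
begin

lemma wv_measurable: "(\<lambda>\<omega>. (w k \<omega>, v k \<omega>)) \<in> measurable M (MW \<Otimes>\<^sub>M MV)"
  using indep unfolding indep_vars_def by blast

lemma w_measurable[measurable]: "w k \<in> measurable M MW"
  using measurable_compose[OF wv_measurable measurable_fst] by simp

lemma v_measurable[measurable]: "v k \<in> measurable M MV"
  using measurable_compose[OF wv_measurable measurable_snd] by simp

lemma gw_measurable[measurable (raw)]:
  assumes "q \<in> measurable A MW" "r \<in> borel_measurable A"
  shows "(\<lambda>z. gw (q z) (r z)) \<in> borel_measurable A"
  using measurable_compose[OF measurable_Pair[OF assms] meas_gw] by simp

lemma dg_measurable[measurable (raw)]:
  assumes "q \<in> measurable A MW" "r \<in> measurable A (restrict_space borel X)"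
  shows "(\<lambda>z. dg (q z) (r z)) \<in> borel_measurable A"
  using measurable_compose[OF measurable_Pair[OF assms] meas_dg] by simp

lemma grad_fv_measurable[measurable (raw)]:
  assumes "q \<in> measurable A MV" "r \<in> borel_measurable A"
  shows "(\<lambda>z. gradient (fv (q z)) (r z)) \<in> borel_measurable A"
  using measurable_compose[OF measurable_Pair[OF assms] meas_grad_fv] by simp

lemma const_in_X_measurable[measurable (raw)]:
  "z \<in> X \<Longrightarrow> (\<lambda>_. z) \<in> measurable A (restrict_space borel X)"
  by (intro measurable_const) (simp add: space_restrict_space)

lemma matrix_vector_mult_measurable[measurable (raw)]:
  fixes A :: "'z \<Rightarrow> real^'q^'p"
  assumes [measurable]: "A \<in> borel_measurable N" "r \<in> borel_measurable N"
  shows "(\<lambda>z. A z *v r z) \<in> borel_measurable N"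
proof -
  have "continuous_on UNIV (\<lambda>(B, s). (B :: real^'q^'p) *v s)"
    unfolding matrix_vector_mult_def split_def
    by (intro continuous_intros)
  then have "(\<lambda>(B, s). (B :: real^'q^'p) *v s) \<in> borel_measurable (borel \<Otimes>\<^sub>M borel)"
    by (simp add: borel_prod borel_measurable_continuous_onI)
  from measurable_compose[OF _ this, of "\<lambda>z. (A z, r z)" N] show ?thesis by simp
qed

text \<open>One iteration with state and sample as separate arguments, so that the state can be held
  fixed while the sample is integrated out.\<close>

definition upd_y :: "real \<Rightarrow> 'w \<Rightarrow> real^'n \<Rightarrow> real^'m \<Rightarrow> real^'m" where
  "upd_y \<beta> s x y = (1 - \<beta>) *\<^sub>R y + \<beta> *\<^sub>R gw s x"

definition direction :: "real \<Rightarrow> 'w \<Rightarrow> 'v \<Rightarrow> real^'n \<Rightarrow> real^'m \<Rightarrow> real^'n" where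
  "direction \<beta> s t x y = dg s x *v gradient (fv t) (upd_y \<beta> s x y)"

definition upd_x :: "real \<Rightarrow> real \<Rightarrow> 'w \<Rightarrow> 'v \<Rightarrow> real^'n \<Rightarrow> real^'m \<Rightarrow> real^'n" where
  "upd_x \<alpha> \<beta> s t x y = closest_point X (x - \<alpha> *\<^sub>R direction \<beta> s t x y)"

text \<open>\<open>dg\<close> is measurable over the restricted space, \<open>gw\<close> over
  \<open>borel\<close>; the same state has to be available in both senses.\<close>

lemma from_restrict_X: "r \<in> measurable A (restrict_space borel X) \<Longrightarrow> r \<in> borel_measurable A"
  by (simp add: measurable_restrict_space2_iff)

lemma upd_y_measurable[measurable (raw)]:
  assumes [measurable]: "q \<in> measurable A MW" "r \<in> borel_measurable A" "r' \<in> borel_measurable A"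
  shows "(\<lambda>z. upd_y \<beta> (q z) (r z) (r' z)) \<in> borel_measurable A"
  unfolding upd_y_def by measurable

lemma direction_measurable[measurable (raw)]:
  assumes [measurable]: "q \<in> measurable A MW" "q' \<in> measurable A MV"
      "r \<in> measurable A (restrict_space borel X)" "r' \<in> borel_measurable A"
  shows "(\<lambda>z. direction \<beta> (q z) (q' z) (r z) (r' z)) \<in> borel_measurable A"
proof -
  note from_restrict_X[OF assms(3), measurable]
  show ?thesis unfolding direction_def by measurable
qed

lemma closest_point_measurable[measurable]: "closest_point X \<in> borel_measurable borel"
  using X_convex X_closed X_nonempty
  by (intro borel_measurable_continuous_onI continuous_on_closest_point)

lemma closest_point_in_X: "closest_point X z \<in> X"
  using X_closed X_nonempty by (rule closest_point_in_set)

lemma closest_point_nonexpansive: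
  assumes "z \<in> X"
  shows "norm (closest_point X u - z) \<le> norm (u - z)"
  using closest_point_lipschitz[OF X_convex X_closed X_nonempty, of u z] assms
  by (simp add: closest_point_self dist_norm)

lemma upd_x_in_X: "upd_x \<alpha> \<beta> s t x y \<in> X"
  unfolding upd_x_def by (rule closest_point_in_X)

lemma upd_x_measurable[measurable (raw)]:
  assumes [measurable]: "q \<in> measurable A MW" "q' \<in> measurable A MV"
      "r \<in> measurable A (restrict_space borel X)" "r' \<in> borel_measurable A"
  shows "(\<lambda>z. upd_x \<alpha> \<beta> (q z) (q' z) (r z) (r' z)) \<in> measurable A (restrict_space borel X)"
proof -
  note from_restrict_X[OF assms(3), measurable]
  have "(\<lambda>z. upd_x \<alpha> \<beta> (q z) (q' z) (r z) (r' z)) \<in> borel_measurable A"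
    unfolding upd_x_def by measurable
  then show ?thesis
    by (auto simp: measurable_restrict_space2_iff upd_x_in_X)
qed

lemma upd_x_borel_measurable[measurable (raw)]:
  assumes "q \<in> measurable A MW" "q' \<in> measurable A MV"
      "r \<in> measurable A (restrict_space borel X)" "r' \<in> borel_measurable A"
  shows "(\<lambda>z. upd_x \<alpha> \<beta> (q z) (q' z) (r z) (r' z)) \<in> borel_measurable A"
  by (rule from_restrict_X[OF upd_x_measurable[OF assms]])

lemma sigma_finite_subalgebra_v: "sigma_finite_subalgebra M (generated_by M MV (v 0))"
  by (rule sigma_finite_subalgebra_generated_by) measurable

lemma dg_second_moment:
  assumes "x \<in> X"
  shows "(\<integral>\<^sup>+\<omega>. ennreal ((norm (dg (w 0 \<omega>) x))\<^sup>2) \<partial>M) \<le> ennreal (real CARD('n) * Cg)"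
proof -
  let ?op = "\<lambda>\<omega>. (op_norm (dg (w 0 \<omega>) x))\<^sup>2"
  have int: "integrable M ?op"
    by (rule AE_cond_exp_integrable[OF dg_bound assms])
  have le: "expectation ?op \<le> Cg"
    using AE_cond_exp_expectation_le[OF sigma_finite_subalgebra_v dg_bound assms, of 1 Cg] by simp
  have "(\<integral>\<^sup>+\<omega>. ennreal ((norm (dg (w 0 \<omega>) x))\<^sup>2) \<partial>M) \<le> (\<integral>\<^sup>+\<omega>. ennreal (real CARD('n) * ?op \<omega>) \<partial>M)"
    by (intro nn_integral_mono ennreal_leI norm_power2_le_op_norm)
  also have "\<dots> = ennreal (expectation (\<lambda>\<omega>. real CARD('n) * ?op \<omega>))"
    using int by (intro nn_integral_eq_integral) auto
  also have "\<dots> \<le> ennreal (real CARD('n) * Cg)"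
    using le by (intro ennreal_leI) (simp add: mult_left_mono)
  finally show ?thesis .
qed

text \<open>The factors of the direction are dependent, but \<open>dg\<close> and the point
  \<open>upd_y\<close> are both functions of \<open>w 0\<close>. Conditioning on \<open>w 0\<close>
  extracts \<open>Cf\<close> with the squared norm of \<open>dg\<close> as weight, and the weight is
  then integrated by itself.\<close>

lemma direction_second_moment:
  assumes [measurable]: "x \<in> X"
  shows "(\<integral>\<^sup>+\<omega>. ennreal ((norm (direction \<beta> (w 0 \<omega>) (v 0 \<omega>) x y))\<^sup>2) \<partial>M)
    \<le> ennreal (Cf * (real CARD('n) * Cg))"
proof -
  have "(\<integral>\<^sup>+\<omega>. ennreal ((norm (direction \<beta> (w 0 \<omega>) (v 0 \<omega>) x y))\<^sup>2) \<partial>M)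
      \<le> (\<integral>\<^sup>+\<omega>. ennreal ((norm (dg (w 0 \<omega>) x))\<^sup>2)
           * ennreal ((norm (gradient (fv (v 0 \<omega>)) (upd_y \<beta> (w 0 \<omega>) x y)))\<^sup>2) \<partial>M)"
  proof (rule nn_integral_mono)
    fix \<omega>
    let ?d = "norm (gradient (fv (v 0 \<omega>)) (upd_y \<beta> (w 0 \<omega>) x y))"
    have "(norm (direction \<beta> (w 0 \<omega>) (v 0 \<omega>) x y))\<^sup>2 \<le> (norm (dg (w 0 \<omega>) x) * ?d)\<^sup>2"
      unfolding direction_def by (intro power_mono norm_matrix_vector_mult_le) simp
    then show "ennreal ((norm (direction \<beta> (w 0 \<omega>) (v 0 \<omega>) x y))\<^sup>2)
        \<le> ennreal ((norm (dg (w 0 \<omega>) x))\<^sup>2) * ennreal (?d\<^sup>2)"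
      by (simp add: power_mult_distrib ennreal_leI flip: ennreal_mult)
  qed
  also have "\<dots> \<le> ennreal Cf * (\<integral>\<^sup>+\<omega>. ennreal ((norm (dg (w 0 \<omega>) x))\<^sup>2) \<partial>M)"
  proof (rule AE_cond_exp_nn_integral_subst_le[OF w_measurable v_measurable meas_grad_fv grad_fv_bound])
    show "AE \<omega> in M. continuous_on UNIV (gradient (fv (v 0 \<omega>)))"
      using grad_fv_lipschitz by eventually_elim (rule lipschitz_on_continuous_on)
  qed measurable
  also have "\<dots> \<le> ennreal Cf * ennreal (real CARD('n) * Cg)"
    by (intro mult_left_mono dg_second_moment assms) simp
  also have "\<dots> = ennreal (Cf * (real CARD('n) * Cg))"
    using consts_pos by (intro ennreal_mult[symmetric]) auto
  finally show ?thesis .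
qed

lemma gw_variance_bound:
  assumes "x \<in> X"
  shows "integrable M (\<lambda>\<omega>. (norm (gw (w 0 \<omega>) x - g x))\<^sup>2)"
    and "expectation (\<lambda>\<omega>. (norm (gw (w 0 \<omega>) x - g x))\<^sup>2) \<le> Vg"
  using AE_cond_exp_integrable[OF gw_variance assms]
    AE_cond_exp_expectation_le[OF sigma_finite_subalgebra_v gw_variance assms, of 1 Vg] by simp_all

text \<open>The new deviation is the deterministic vector
  \<open>(1 - \<beta>) *\<^sub>R (y - g x)\<close> plus centred noise, so the cross term has mean
  zero.\<close>

lemma tracking_step:
  assumes x: "x \<in> X"
  shows "integrable M (\<lambda>\<omega>. (norm (upd_y \<beta> (w 0 \<omega>) x y - g x))\<^sup>2)"
    and "expectation (\<lambda>\<omega>. (norm (upd_y \<beta> (w 0 \<omega>) x y - g x))\<^sup>2)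
      \<le> (1 - \<beta>)\<^sup>2 * (norm (y - g x))\<^sup>2 + \<beta>\<^sup>2 * Vg"
proof -
  note int = gw_variance_bound(1)[OF x] g_mean(1)[of x]
  have eq: "(norm (upd_y \<beta> (w 0 \<omega>) x y - g x))\<^sup>2 = (1 - \<beta>)\<^sup>2 * (norm (y - g x))\<^sup>2
      + 2 * (1 - \<beta>) * \<beta> * ((gw (w 0 \<omega>) x - g x) \<bullet> (y - g x))
      + \<beta>\<^sup>2 * (norm (gw (w 0 \<omega>) x - g x))\<^sup>2" for \<omega>
  proof -
    have "upd_y \<beta> (w 0 \<omega>) x y - g x = (1 - \<beta>) *\<^sub>R (y - g x) + \<beta> *\<^sub>R (gw (w 0 \<omega>) x - g x)"
      by (simp add: upd_y_def algebra_simps)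
    then show ?thesis
      by (simp add: power2_norm_eq_inner inner_add_left inner_add_right inner_commute
          power2_eq_square[of \<beta>] power2_eq_square[of "1 - \<beta>"])
  qed
  show "integrable M (\<lambda>\<omega>. (norm (upd_y \<beta> (w 0 \<omega>) x y - g x))\<^sup>2)"
    unfolding eq using int by simp
  have "expectation (\<lambda>\<omega>. (gw (w 0 \<omega>) x - g x) \<bullet> (y - g x)) = 0"
    using int g_mean(2)[of x] by (simp add: prob_space)
  then have "expectation (\<lambda>\<omega>. (norm (upd_y \<beta> (w 0 \<omega>) x y - g x))\<^sup>2)
      = (1 - \<beta>)\<^sup>2 * (norm (y - g x))\<^sup>2 + \<beta>\<^sup>2 * expectation (\<lambda>\<omega>. (norm (gw (w 0 \<omega>) x - g x))\<^sup>2)"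
    unfolding eq using int by (simp add: prob_space)
  also have "\<dots> \<le> (1 - \<beta>)\<^sup>2 * (norm (y - g x))\<^sup>2 + \<beta>\<^sup>2 * Vg"
    using gw_variance_bound(2)[OF x] by (simp add: mult_left_mono)
  finally show "expectation (\<lambda>\<omega>. (norm (upd_y \<beta> (w 0 \<omega>) x y - g x))\<^sup>2)
      \<le> (1 - \<beta>)\<^sup>2 * (norm (y - g x))\<^sup>2 + \<beta>\<^sup>2 * Vg" .
qed

lemma descent_step:
  assumes x[measurable]: "x \<in> X" and z: "z \<in> X" and \<alpha>: "0 < \<alpha>" and \<beta>: "0 < \<beta>"
    and diam: "\<And>u. u \<in> X \<Longrightarrow> (norm (u - z))\<^sup>2 \<le> Dx"
  shows "expectation (\<lambda>\<omega>. (norm (upd_x \<alpha> \<beta> (w 0 \<omega>) (v 0 \<omega>) x y - z))\<^sup>2)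
        + 2 * \<alpha> * (f (g x) - f (g z))
    \<le> (norm (x - z))\<^sup>2 + \<alpha>\<^sup>2 * (Cf * (real CARD('n) * Cg))
      + \<alpha>\<^sup>2 / \<beta> * (Lf\<^sup>2 * Dx * (real CARD('n) * Cg))
      + \<beta> * expectation (\<lambda>\<omega>. (norm (upd_y \<beta> (w 0 \<omega>) x y - g x))\<^sup>2)"
proof -
  let ?x' = "\<lambda>\<omega>. upd_x \<alpha> \<beta> (w 0 \<omega>) (v 0 \<omega>) x y"
  let ?G = "\<lambda>\<omega>. direction \<beta> (w 0 \<omega>) (v 0 \<omega>) x y"
  let ?e = "\<lambda>\<omega>. upd_y \<beta> (w 0 \<omega>) x y - g x"
  let ?S = "\<lambda>\<omega>. dg (w 0 \<omega>) x *v gradient (fv (v 0 \<omega>)) (g x)"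
  let ?n = "real CARD('n)"
  have int_x': "integrable M (\<lambda>\<omega>. (norm (?x' \<omega> - z))\<^sup>2)"
    using diam[OF upd_x_in_X]
    by (intro integrable_const_bound[where B = Dx]) auto
  have G: "integrable M (\<lambda>\<omega>. (norm (?G \<omega>))\<^sup>2)" "expectation (\<lambda>\<omega>. (norm (?G \<omega>))\<^sup>2) \<le> Cf * (?n * Cg)"
    using consts_pos
    by (auto intro!: nonneg_integral_le_of_nn_integral_le[OF _ _ _ direction_second_moment[OF x]])
  have dg2: "integrable M (\<lambda>\<omega>. (norm (dg (w 0 \<omega>) x))\<^sup>2)" "expectation (\<lambda>\<omega>. (norm (dg (w 0 \<omega>) x))\<^sup>2) \<le> ?n * Cg"
    using consts_pos
    by (auto intro!: nonneg_integral_le_of_nn_integral_le[OF _ _ _ dg_second_moment[OF x]])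
  have S: "integrable M ?S"
    by (rule AE_cond_exp_integrable[OF grad_unbiased x])
  \<comment> \<open>The mean of \<open>?S\<close> behaves as a subgradient of the composition at
    \<open>x\<close>; the subgradient inequality is tested at \<open>z\<close>.\<close>
  have "expectation (\<lambda>\<omega>. ?S \<omega> \<bullet> (z - x)) \<le> f (g z) - f (g x)"
    using sigma_finite_subalgebra_v grad_unbiased x
    by (rule AE_cond_exp_expectation_le) (auto simp: subdifferential_def algebra_simps)
  moreover have "AE \<omega> in M. (norm (?x' \<omega> - z))\<^sup>2 \<le> (norm (x - z))\<^sup>2 + 2 * \<alpha> * (?S \<omega> \<bullet> (z - x))
      + \<alpha>\<^sup>2 * (norm (?G \<omega>))\<^sup>2 + \<alpha>\<^sup>2 / \<beta> * (Lf\<^sup>2 * Dx * (norm (dg (w 0 \<omega>) x))\<^sup>2) + \<beta> * (norm (?e \<omega>))\<^sup>2"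
    using grad_fv_lipschitz
  proof eventually_elim
    case (elim \<omega>)
    let ?c = "2 * \<alpha> * ((?G \<omega> - ?S \<omega>) \<bullet> (z - x))"
    let ?d = "norm (dg (w 0 \<omega>) x)"
    have "(norm (?x' \<omega> - z))\<^sup>2 \<le> (norm (x - \<alpha> *\<^sub>R ?G \<omega> - z))\<^sup>2"
      unfolding upd_x_def by (intro power_mono closest_point_nonexpansive z) simp
    also have "\<dots> = (norm (x - z))\<^sup>2 + 2 * \<alpha> * (?S \<omega> \<bullet> (z - x)) + \<alpha>\<^sup>2 * (norm (?G \<omega>))\<^sup>2 + ?c"
      unfolding power2_norm_eq_inner
      by (simp add: inner_diff_left inner_diff_right inner_commute power2_eq_square[of \<alpha>] algebra_simps)
    also have "?c \<le> \<alpha>\<^sup>2 / \<beta> * (Lf\<^sup>2 * Dx * ?d\<^sup>2) + \<beta> * (norm (?e \<omega>))\<^sup>2"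
    proof -
      have "norm (?G \<omega> - ?S \<omega>)
          = norm (dg (w 0 \<omega>) x *v (gradient (fv (v 0 \<omega>)) (upd_y \<beta> (w 0 \<omega>) x y) - gradient (fv (v 0 \<omega>)) (g x)))"
        by (simp add: direction_def matrix_vector_mult_diff_distrib)
      also have "\<dots> \<le> ?d * norm (gradient (fv (v 0 \<omega>)) (upd_y \<beta> (w 0 \<omega>) x y) - gradient (fv (v 0 \<omega>)) (g x))"
        by (rule norm_matrix_vector_mult_le)
      also have "\<dots> \<le> ?d * (Lf * norm (?e \<omega>))"
        using lipschitz_onD[OF elim] by (intro mult_left_mono) (auto simp: dist_norm)
      finally have *: "norm (?G \<omega> - ?S \<omega>) \<le> ?d * (Lf * norm (?e \<omega>))" .
      have "?c \<le> 2 * \<alpha> * (norm (?G \<omega> - ?S \<omega>) * norm (z - x))"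
        using \<alpha> by (intro mult_left_mono norm_cauchy_schwarz) simp
      also have "\<dots> \<le> 2 * \<alpha> * ((?d * (Lf * norm (?e \<omega>))) * norm (z - x))"
        using \<alpha> * by (intro mult_left_mono mult_right_mono) auto
      \<comment> \<open>\<open>?d\<close> and \<open>?e\<close> depend on the same sample, so the
        mean of the product of their squares is not controlled. \<open>?d\<close> is therefore
        grouped with \<open>norm (x - z)\<close>, which the diameter bounds, and Young's inequality
        leaves \<open>?e\<close> alone.\<close>
      also have "\<dots> = 2 * (\<alpha> * Lf * norm (x - z) * ?d) * norm (?e \<omega>)"
        by (simp add: norm_minus_commute)
      also have "\<dots> \<le> (\<alpha> * Lf * norm (x - z) * ?d)\<^sup>2 / \<beta> + \<beta> * (norm (?e \<omega>))\<^sup>2"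
      proof -
        have "2 * p * q \<le> p\<^sup>2 / \<beta> + \<beta> * q\<^sup>2" for p q :: real
        proof -
          have "0 \<le> (p - \<beta> * q)\<^sup>2 / \<beta>" using \<beta> by simp
          also have "\<dots> = p\<^sup>2 / \<beta> + \<beta> * q\<^sup>2 - 2 * p * q"
            using \<beta> by (simp add: power2_eq_square field_simps)
          finally show ?thesis by simp
        qed
        then show ?thesis .
      qed
      also have "(\<alpha> * Lf * norm (x - z) * ?d)\<^sup>2 / \<beta> = \<alpha>\<^sup>2 / \<beta> * (Lf\<^sup>2 * (norm (x - z))\<^sup>2 * ?d\<^sup>2)"
        by (simp add: power_mult_distrib)
      also have "\<dots> \<le> \<alpha>\<^sup>2 / \<beta> * (Lf\<^sup>2 * Dx * ?d\<^sup>2)"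
        using \<beta> diam[OF x] by (intro mult_left_mono mult_right_mono) auto
      finally show ?thesis by simp
    qed
    finally show ?case by simp
  qed
  then have "expectation (\<lambda>\<omega>. (norm (?x' \<omega> - z))\<^sup>2) \<le> expectation (\<lambda>\<omega>. (norm (x - z))\<^sup>2 + 2 * \<alpha> * (?S \<omega> \<bullet> (z - x))
      + \<alpha>\<^sup>2 * (norm (?G \<omega>))\<^sup>2 + \<alpha>\<^sup>2 / \<beta> * (Lf\<^sup>2 * Dx * (norm (dg (w 0 \<omega>) x))\<^sup>2) + \<beta> * (norm (?e \<omega>))\<^sup>2)"
    using int_x' G(1) dg2(1) S tracking_step(1)[OF x] by (intro integral_mono_AE) auto
  then have "expectation (\<lambda>\<omega>. (norm (?x' \<omega> - z))\<^sup>2) \<le> (norm (x - z))\<^sup>2 + 2 * \<alpha> * expectation (\<lambda>\<omega>. ?S \<omega> \<bullet> (z - x))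
      + \<alpha>\<^sup>2 * expectation (\<lambda>\<omega>. (norm (?G \<omega>))\<^sup>2)
      + \<alpha>\<^sup>2 / \<beta> * (Lf\<^sup>2 * Dx * expectation (\<lambda>\<omega>. (norm (dg (w 0 \<omega>) x))\<^sup>2)) + \<beta> * expectation (\<lambda>\<omega>. (norm (?e \<omega>))\<^sup>2)"
    using G(1) dg2(1) S tracking_step(1)[OF x] by (simp add: prob_space)
  moreover have "2 * \<alpha> * expectation (\<lambda>\<omega>. ?S \<omega> \<bullet> (z - x)) \<le> 2 * \<alpha> * (f (g z) - f (g x))"
    using calculation(1) \<alpha> by (intro mult_left_mono) auto
  moreover have "\<alpha>\<^sup>2 * expectation (\<lambda>\<omega>. (norm (?G \<omega>))\<^sup>2) \<le> \<alpha>\<^sup>2 * (Cf * (?n * Cg))"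
    using G(2) by (intro mult_left_mono) auto
  moreover have "\<alpha>\<^sup>2 / \<beta> * (Lf\<^sup>2 * Dx * expectation (\<lambda>\<omega>. (norm (dg (w 0 \<omega>) x))\<^sup>2)) \<le> \<alpha>\<^sup>2 / \<beta> * (Lf\<^sup>2 * Dx * (?n * Cg))"
    using dg2(2) \<beta> order_trans[OF zero_le_power2 diam[OF x]] by (intro mult_left_mono) auto
  ultimately show ?thesis by (simp add: algebra_simps)
qed

end

subsection \<open>Summation over the window\<close>

text \<open>Every index of the window is at least half of \<open>k\<close>, so powers of the index
  and of \<open>k\<close> are comparable for exponents of either sign.\<close>

lemma window_bounds:
  assumes "k \<ge> 1"
  shows "1 \<le> window k" "window k \<le> k" "real k \<le> 2 * real (window k)"
    "\<And>t. t \<in> {k - window k + 1..k} \<Longrightarrow> 1 \<le> t \<and> real k \<le> 2 * real t"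
proof -
  have w: "int (window k) = \<lceil>real k / 2\<rceil>" unfolding window_def by simp
  have "real k / 2 \<le> of_int (int (window k))" "of_int (int (window k)) < real k / 2 + 1"
    unfolding w by linarith+
  then have *: "real k \<le> 2 * real (window k)" "2 * real (window k) < real k + 2" by auto
  then show "real k \<le> 2 * real (window k)" by simp
  have **: "k \<le> 2 * window k" "2 * window k < k + 2"
    using * by linarith+
  then show "1 \<le> window k" "window k \<le> k" using assms by auto
  show "1 \<le> t \<and> real k \<le> 2 * real t" if "t \<in> {k - window k + 1..k}" for t
    using that ** by auto
qed

lemma powr_window_le:
  fixes p :: real
  assumes "1 \<le> t" "t \<le> k" "real k \<le> 2 * real t"
  shows "real t powr p \<le> 2 powr \<bar>p\<bar> * real k powr p"
proof (cases "0 \<le> p")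
  case True
  have "real t powr p \<le> 1 * real k powr p" using assms True by (simp add: powr_mono2)
  also have "\<dots> \<le> 2 powr \<bar>p\<bar> * real k powr p"
    by (intro mult_right_mono) (auto simp: ge_one_powr_ge_zero)
  finally show ?thesis .
next
  case False
  have "2 powr p * real t powr p = (2 * real t) powr p" using assms by (simp add: powr_mult)
  also have "\<dots> \<le> real k powr p" using assms False by (intro powr_mono2') auto
  finally have "2 powr - p * (2 powr p * real t powr p) \<le> 2 powr - p * real k powr p"
    by (intro mult_left_mono) auto
  then show ?thesis using False by (simp add: powr_add[symmetric] flip: mult.assoc)
qed

text \<open>The tracking recursion at step \<open>k\<close> contains the previous stepsize, because
  the target moved from \<open>g (x (k - 1))\<close> to \<open>g (x k)\<close>. The arbitrary
  \<open>\<alpha> 0\<close> is covered by \<open>\<alpha> 1 = 1\<close>.\<close>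

lemma powr_stepsize_pred_le:
  fixes \<alpha> :: "nat \<Rightarrow> real"
  assumes a: "0 < a" "a < 1" and \<alpha>0: "\<alpha> 0 \<in> {0<..1}" and \<alpha>: "\<And>k. k \<ge> 1 \<Longrightarrow> \<alpha> k = real k powr (- a)"
  shows "(\<alpha> k)\<^sup>2 \<le> 4 * (\<alpha> (Suc k))\<^sup>2"
proof -
  have pos: "0 \<le> \<alpha> k" using \<alpha>0 \<alpha>[of k] by (cases k) auto
  have "\<alpha> k \<le> 2 * \<alpha> (Suc k)"
  proof (cases "k = 0")
    case True
    then show ?thesis using \<alpha>0 \<alpha>[of 1] by simp
  next
    case False
    have "2 powr (- a) * real k powr (- a) = (2 * real k) powr (- a)"
      by (simp add: powr_mult)
    also have "\<dots> \<le> real (Suc k) powr (- a)" using False a by (intro powr_mono2') auto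
    finally have "2 powr a * (2 powr (- a) * real k powr (- a)) \<le> 2 powr a * real (Suc k) powr (- a)"
      by (intro mult_left_mono) auto
    then have "real k powr (- a) \<le> 2 powr a * real (Suc k) powr (- a)"
      by (simp add: powr_add[symmetric] flip: mult.assoc)
    also have "\<dots> \<le> 2 powr 1 * real (Suc k) powr (- a)"
      using a by (intro mult_right_mono powr_mono) auto
    finally show ?thesis using False \<alpha>[of k] \<alpha>[of "Suc k"] by simp
  qed
  then have "(\<alpha> k)\<^sup>2 \<le> (2 * \<alpha> (Suc k))\<^sup>2" using pos by (intro power_mono)
  then show ?thesis by (simp add: power_mult_distrib)
qed

text \<open>Summation by parts: all increments of \<open>r\<close> are nonnegative and meet values
  of \<open>J\<close> at most \<open>B\<close>, so they add up to no more than the last weight times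
  \<open>B\<close>.\<close>

lemma weighted_telescope_le:
  fixes J r :: "nat \<Rightarrow> real"
  assumes J: "\<And>t. t \<in> {m..Suc k} \<Longrightarrow> 0 \<le> J t \<and> J t \<le> B"
    and r: "\<And>t. t \<in> {m..k} \<Longrightarrow> 0 \<le> r t" "\<And>t. m \<le> t \<Longrightarrow> t < k \<Longrightarrow> r t \<le> r (Suc t)"
    and "m \<le> k"
  shows "(\<Sum>t=m..k. r t * (J t - J (Suc t))) \<le> B * r k"
proof -
  \<comment> \<open>The extra term \<open>- r k * J (Suc k)\<close> makes the claim inductive; the
    step then amounts to \<open>(r (Suc n) - r n) * (B - J (Suc n))\<close> being
    nonnegative.\<close>
  have "(\<Sum>t=m..k. r t * (J t - J (Suc t))) \<le> B * r k - r k * J (Suc k)"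
    using \<open>m \<le> k\<close> J r
  proof (induction k rule: dec_induct)
    case base
    then have "r m * J m \<le> r m * B" by (intro mult_left_mono) auto
    then show ?case by (simp add: algebra_simps)
  next
    case (step n)
    have "(\<Sum>t=m..n. r t * (J t - J (Suc t))) \<le> B * r n - r n * J (Suc n)"
      using step.prems by (intro step.IH) auto
    moreover have "0 \<le> (r (Suc n) - r n) * (B - J (Suc n))"
      using step.prems step.hyps by (intro mult_nonneg_nonneg) auto
    ultimately show ?case using step.hyps by (simp add: algebra_simps)
  qed
  moreover have "0 \<le> r k * J (Suc k)"
    using J[of "Suc k"] r(1)[of k] \<open>m \<le> k\<close> by auto
  ultimately show ?thesis by linarith
qed

text \<open>The tracking error \<open>\<beta> k * T (Suc k)\<close> in the descent recursion is absorbed by the decrease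
  of \<open>T\<close>, so \<open>D + T\<close> serves as a Lyapunov function.\<close>

lemma lyapunov_step:
  fixes D D' T T' \<beta> c d :: real
  assumes "D' + E \<le> D + c + \<beta> * T'" "T' \<le> (1 - \<beta>) * T + d" "0 \<le> T" "0 \<le> d" "0 < \<beta>" "\<beta> \<le> 1"
  shows "D' + T' + E \<le> D + T + c + 2 * d"
proof -
  \<comment> \<open>On the left \<open>T'\<close> is counted once for the Lyapunov function and
    \<open>\<beta>\<close> times for the descent error. The factors \<open>1 + \<beta>\<close> and
    \<open>1 - \<beta>\<close> multiply to at most 1, and \<open>1 + \<beta>\<close> is at most 2,
    whence \<open>2 * d\<close>.\<close>
  have "(1 + \<beta>) * T' \<le> (1 + \<beta>) * ((1 - \<beta>) * T + d)"
    using assms by (intro mult_left_mono) auto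
  also have "\<dots> = T - \<beta>\<^sup>2 * T + d + \<beta> * d"
    by (simp add: algebra_simps power2_eq_square)
  also have "\<dots> \<le> T + 2 * d"
    using assms mult_left_le_one_le[of d \<beta>] mult_nonneg_nonneg[OF zero_le_power2[of \<beta>], of T] by linarith
  finally show ?thesis using assms(1) by (simp add: algebra_simps)
qed

text \<open>The probability-free core. \<open>D\<close>, \<open>T\<close> and \<open>E\<close> stand
  for the expected squared distance, tracking error and optimality gap, and \<open>c1\<close> to
  \<open>c4\<close> collect the problem constants.\<close>

lemma scgd_recursion_rate:
  fixes D T E \<alpha> \<beta> :: "nat \<Rightarrow> real"
  assumes a: "0 < a" "a < 1" and b: "0 < b" "b < 1"
    and \<alpha>0: "\<alpha> 0 \<in> {0<..1}" and \<alpha>: "\<And>k. k \<ge> 1 \<Longrightarrow> \<alpha> k = real k powr (- a)"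
    and \<beta>: "\<And>k. k \<ge> 1 \<Longrightarrow> \<beta> k = real k powr (- b)"
    and D: "\<And>k. 0 \<le> D k" "\<And>k. D k \<le> Dx" and T: "\<And>k. 0 \<le> T k" "\<And>k. k \<ge> 1 \<Longrightarrow> T k \<le> Dy"
    and E_nonneg: "\<And>k. 0 \<le> E k"
    and c: "0 \<le> c1" "0 \<le> c2" "0 \<le> c3" "0 \<le> c4" and Dxy: "0 < Dx" "0 < Dy"
    and rec_D: "\<And>k. k \<ge> 1 \<Longrightarrow> D (Suc k) + 2 * \<alpha> k * E k
        \<le> D k + (\<alpha> k)\<^sup>2 * c1 + (\<alpha> k)\<^sup>2 / \<beta> k * c2 + \<beta> k * T (Suc k)"
    and rec_T: "\<And>k. k \<ge> 1 \<Longrightarrow> T (Suc k)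
        \<le> (1 - \<beta> k) * T k + (\<alpha> (k - 1))\<^sup>2 / \<beta> k * c3 + (\<beta> k)\<^sup>2 * c4"
  shows "\<exists>c>0. \<forall>k\<ge>1. (\<Sum>t=k - window k + 1..k. E t) / real (window k)
    \<le> c * (real k powr (a - 1) + real k powr (b - a) + real k powr (a - 2 * b))"
proof -
  \<comment> \<open>The tracking terms carry a factor 2 from \<open>lyapunov_step\<close>;
    \<open>c3\<close> carries another 4 from replacing \<open>\<alpha> (k - 1)\<close> by
    \<open>\<alpha> k\<close>.\<close>
  define C where "C = c1 + c2 + 8 * c3 + 2 * c4"
  define B where "B = Dx + Dy"
  define J where "J k = D k + T k" for k
  have C: "0 \<le> C" and B: "0 < B" using c Dxy by (auto simp: C_def B_def)
  have J: "0 \<le> J k \<and> J k \<le> B" if "k \<ge> 1" for k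
    using D[of k] T[of k] that by (auto simp: J_def B_def)
  have E: "E k \<le> real k powr a * (J k - J (Suc k)) + C * (real k powr (b - a) + real k powr (a - 2 * b))"
    if k: "k \<ge> 1" for k
  proof -
    have \<alpha>k: "0 < \<alpha> k" and \<beta>k: "0 < \<beta> k" "\<beta> k \<le> 1"
      using k a b by (auto simp: \<alpha> \<beta> powr_le1 powr_minus_divide ge_one_powr_ge_zero)
    define d where "d = (\<alpha> (k - 1))\<^sup>2 / \<beta> k * c3 + (\<beta> k)\<^sup>2 * c4"
    have "D (Suc k) + T (Suc k) + 2 * \<alpha> k * E k
        \<le> D k + T k + ((\<alpha> k)\<^sup>2 * c1 + (\<alpha> k)\<^sup>2 / \<beta> k * c2) + 2 * d"
      using rec_D[OF k] rec_T[OF k] T(1)[of k] c \<beta>k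
      by (intro lyapunov_step) (auto simp: d_def)
    moreover have "d \<le> 4 * ((\<alpha> k)\<^sup>2 / \<beta> k * c3) + (\<beta> k)\<^sup>2 * c4"
    proof -
      have "(\<alpha> (k - 1))\<^sup>2 \<le> 4 * (\<alpha> k)\<^sup>2"
        using powr_stepsize_pred_le[OF a \<alpha>0 \<alpha>, of "k - 1"] k by simp
      then have "(\<alpha> (k - 1))\<^sup>2 / \<beta> k * c3 \<le> (4 * (\<alpha> k)\<^sup>2) / \<beta> k * c3"
        using \<beta>k c by (intro mult_right_mono divide_right_mono) auto
      then show ?thesis by (simp add: d_def algebra_simps)
    qed
    \<comment> \<open>As \<open>\<beta> k\<close> is at most 1, the squared step is absorbed into
      the term with quotient by \<open>\<beta> k\<close>.\<close>
    moreover have "(\<alpha> k)\<^sup>2 * c1 \<le> (\<alpha> k)\<^sup>2 / \<beta> k * c1"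
    proof -
      have "(\<alpha> k)\<^sup>2 \<le> (\<alpha> k)\<^sup>2 / \<beta> k" using \<beta>k by (simp add: pos_le_divide_eq mult_left_le)
      then show ?thesis using c(1) by (rule mult_right_mono)
    qed
    ultimately have "2 * \<alpha> k * E k \<le> J k - J (Suc k)
        + ((\<alpha> k)\<^sup>2 / \<beta> k * c1 + (\<alpha> k)\<^sup>2 / \<beta> k * c2 + 8 * ((\<alpha> k)\<^sup>2 / \<beta> k * c3)) + 2 * ((\<beta> k)\<^sup>2 * c4)"
      unfolding J_def by linarith
    also have "\<dots> = J k - J (Suc k) + (\<alpha> k)\<^sup>2 / \<beta> k * (c1 + c2 + 8 * c3) + (\<beta> k)\<^sup>2 * (2 * c4)"
      by (simp add: distrib_left mult.left_commute)
    also have "\<dots> \<le> J k - J (Suc k) + (\<alpha> k)\<^sup>2 / \<beta> k * C + (\<beta> k)\<^sup>2 * C"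
      using \<beta>k c by (intro add_mono mult_left_mono) (auto simp: C_def)
    finally have "\<alpha> k * (2 * E k) \<le> J k - J (Suc k) + (\<alpha> k)\<^sup>2 / \<beta> k * C + (\<beta> k)\<^sup>2 * C" 
      by (simp add: mult.assoc mult.left_commute)
    then have "2 * E k \<le> (J k - J (Suc k) + (\<alpha> k)\<^sup>2 / \<beta> k * C + (\<beta> k)\<^sup>2 * C) / \<alpha> k"
      using \<alpha>k by (simp add: pos_le_divide_eq mult.commute)
    also have "\<dots> = real k powr a * (J k - J (Suc k)) + C * (real k powr (b - a) + real k powr (a - 2 * b))"
    proof -
      have "1 / \<alpha> k = real k powr a" "\<alpha> k / \<beta> k = real k powr (b - a)" "(\<beta> k)\<^sup>2 / \<alpha> k = real k powr (a - 2 * b)"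
        using k by (auto simp: \<alpha> \<beta> powr_minus_divide power2_eq_square powr_diff powr_add[symmetric])
      moreover have "(J k - J (Suc k) + (\<alpha> k)\<^sup>2 / \<beta> k * C + (\<beta> k)\<^sup>2 * C) / \<alpha> k
          = 1 / \<alpha> k * (J k - J (Suc k)) + C * (\<alpha> k / \<beta> k + (\<beta> k)\<^sup>2 / \<alpha> k)"
        using \<alpha>k \<beta>k by (simp add: field_simps power2_eq_square)
      ultimately show ?thesis by simp
    qed
    \<comment> \<open>The factor 2 in front of \<open>E k\<close> is given away.\<close>
    finally show ?thesis using E_nonneg[of k] by linarith
  qed
  \<comment> \<open>\<open>2 * B\<close> comes from the window having at least \<open>k/2\<close>
    indices. The factors 4 and 8 are \<open>2 powr 2\<close> and \<open>2 powr 3\<close>, from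
    \<open>powr_window_le\<close> with the crude bounds 2 and 3 on the absolute values of
    \<open>b - a\<close> and \<open>a - 2 * b\<close>.\<close>
  define c where "c = 2 * B + C * 4 + C * 8"
  show ?thesis
  proof (intro exI[of _ c] conjI allI impI)
    show "0 < c" using B C by (simp add: c_def)
    fix k :: nat assume k: "k \<ge> 1"
    let ?m = "k - window k + 1"
    note wb = window_bounds[OF k]
    have m: "?m \<le> k" using wb by simp
    have N: "0 < real (window k)" using wb(1) by simp
    have win: "C * (real t powr (b - a) + real t powr (a - 2 * b))
        \<le> C * (2 powr 2 * real k powr (b - a) + 2 powr 3 * real k powr (a - 2 * b))"
      if t: "t \<in> {?m..k}" for t
    proof -
      have *: "real t powr p \<le> 2 powr q * real k powr p" if "\<bar>p\<bar> \<le> q" for p q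
      proof -
        have "real t powr p \<le> 2 powr \<bar>p\<bar> * real k powr p"
          using wb(4)[OF t] t by (intro powr_window_le) auto
        also have "\<dots> \<le> 2 powr q * real k powr p"
          using that by (intro mult_right_mono powr_mono) auto
        finally show ?thesis .
      qed
      show ?thesis using a b C by (intro mult_left_mono add_mono *) auto
    qed
    have "(\<Sum>t=?m..k. E t) \<le> (\<Sum>t=?m..k. real t powr a * (J t - J (Suc t)) +
        C * (2 powr 2 * real k powr (b - a) + 2 powr 3 * real k powr (a - 2 * b)))"
      using wb(4) by (intro sum_mono order_trans[OF E] add_left_mono win) auto
    also have "\<dots> = (\<Sum>t=?m..k. real t powr a * (J t - J (Suc t)))
        + real (window k) * (C * (2 powr 2 * real k powr (b - a) + 2 powr 3 * real k powr (a - 2 * b)))"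
      using wb(2) by (simp add: sum.distrib)
    also have "(\<Sum>t=?m..k. real t powr a * (J t - J (Suc t))) \<le> B * real k powr a"
      using a m by (intro weighted_telescope_le J powr_mono2) auto
    finally have "(\<Sum>t=?m..k. E t) / real (window k)
      \<le> B * real k powr a / real (window k) + C * (2 powr 2 * real k powr (b - a) + 2 powr 3 * real k powr (a - 2 * b))"
      using N by (simp add: field_simps)
    also have "B * real k powr a / real (window k) \<le> B * real k powr a / (real k / 2)"
      using B N wb(3) k by (intro divide_left_mono) auto
    also have "\<dots> = 2 * B * real k powr (a - 1)"
      using k by (simp add: powr_diff)
    finally have "(\<Sum>t=?m..k. E t) / real (window k)
      \<le> 2 * B * real k powr (a - 1) + C * (4 * real k powr (b - a) + 8 * real k powr (a - 2 * b))"
      by simp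
    also have "\<dots> = 2 * B * real k powr (a - 1) + C * 4 * real k powr (b - a) + C * 8 * real k powr (a - 2 * b)"
      by (simp add: algebra_simps)
    also have "\<dots> \<le> c * real k powr (a - 1) + c * real k powr (b - a) + c * real k powr (a - 2 * b)"
      using B C by (intro add_mono mult_right_mono) (auto simp: c_def)
    finally show "(\<Sum>t=?m..k. E t) / real (window k)
      \<le> c * (real k powr (a - 1) + real k powr (b - a) + real k powr (a - 2 * b))"
      by (simp add: algebra_simps)
  qed
qed

subsection \<open>Independence of the current state from the next sample\<close>

text \<open>The iterates as functions of the sample sequence \<open>z\<close>; after \<open>k\<close> steps only
  \<open>z 0, \<dots>, z (k - 1)\<close> have been used, which gives independence from the \<open>k\<close>-th sample.\<close>

context scgd_setting
begin

primrec path :: "(nat \<Rightarrow> real) \<Rightarrow> (nat \<Rightarrow> real) \<Rightarrow> real^'n \<Rightarrow> real^'m \<Rightarrow> nat \<Rightarrow> (nat \<Rightarrow> 'w \<times> 'v)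
    \<Rightarrow> (real^'n) \<times> (real^'m)" where
  "path \<alpha> \<beta> x0 y0 0 z = (x0, y0)"
| "path \<alpha> \<beta> x0 y0 (Suc k) z =
     (let p = path \<alpha> \<beta> x0 y0 k z
      in (upd_x (\<alpha> k) (\<beta> k) (fst (z k)) (snd (z k)) (fst p) (snd p),
          upd_y (\<beta> k) (fst (z k)) (fst p) (snd p)))"

abbreviation state_space :: "((real^'n) \<times> (real^'m)) measure" where
  "state_space \<equiv> restrict_space borel X \<Otimes>\<^sub>M borel"

lemma path_cong:
  "(\<And>i. i < k \<Longrightarrow> z i = z' i) \<Longrightarrow> path \<alpha> \<beta> x0 y0 k z = path \<alpha> \<beta> x0 y0 k z'"
  by (induction k) (auto simp: Let_def)

lemma path_measurable:
  assumes "x0 \<in> X"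
  shows "path \<alpha> \<beta> x0 y0 k \<in> measurable (PiM {..<k} (\<lambda>_. MW \<Otimes>\<^sub>M MV)) state_space"
proof (induction k)
  case 0
  show ?case
    using assms by (simp add: space_pair_measure space_restrict_space)
next
  case (Suc k)
  let ?P = "PiM {..<Suc k} (\<lambda>_. MW \<Otimes>\<^sub>M MV)"
  \<comment> \<open>The induction hypothesis lives on the product over \<open>{..<k}\<close>.
    Restriction carries it to the larger product, and \<open>path\<close> does not notice the
    restriction.\<close>
  have "(\<lambda>z. path \<alpha> \<beta> x0 y0 k (restrict z {..<k})) \<in> measurable ?P state_space"
    by (rule measurable_compose[OF measurable_restrict_subset Suc]) auto
  also have "(\<lambda>z. path \<alpha> \<beta> x0 y0 k (restrict z {..<k})) = path \<alpha> \<beta> x0 y0 k"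
    by (intro ext path_cong) simp
  finally have [measurable]: "path \<alpha> \<beta> x0 y0 k \<in> measurable ?P state_space" .
  have [measurable]: "(\<lambda>z. z k) \<in> measurable ?P (MW \<Otimes>\<^sub>M MV)"
    by (rule measurable_component_singleton) simp
  have [measurable]: "(\<lambda>z. fst (path \<alpha> \<beta> x0 y0 k z)) \<in> measurable ?P (restrict_space borel X)"
    by measurable
  note from_restrict_X[OF this, measurable]
  have "(\<lambda>z. (upd_x (\<alpha> k) (\<beta> k) (fst (z k)) (snd (z k)) (fst (path \<alpha> \<beta> x0 y0 k z)) (snd (path \<alpha> \<beta> x0 y0 k z)),
      upd_y (\<beta> k) (fst (z k)) (fst (path \<alpha> \<beta> x0 y0 k z)) (snd (path \<alpha> \<beta> x0 y0 k z))))
      \<in> measurable ?P state_space"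
    by measurable
  then show ?case by (simp add: Let_def)
qed

lemma iterates_eq_path:
  assumes "scgd_iterates M w v X fv gw dg \<alpha> \<beta> x0 y0 x y" "\<omega> \<in> space M"
  shows "(x k \<omega>, y k \<omega>) = path \<alpha> \<beta> x0 y0 k (\<lambda>i. (w i \<omega>, v i \<omega>))"
proof (induction k)
  case 0
  then show ?case using assms by (simp add: scgd_iterates_def)
next
  case (Suc k)
  have "x k \<omega> = fst (path \<alpha> \<beta> x0 y0 k (\<lambda>i. (w i \<omega>, v i \<omega>)))"
    "y k \<omega> = snd (path \<alpha> \<beta> x0 y0 k (\<lambda>i. (w i \<omega>, v i \<omega>)))"
    by (simp_all flip: Suc)
  then show ?case using assms
    by (simp add: scgd_iterates_def Let_def upd_x_def upd_y_def direction_def)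
qed

text \<open>The substitute for conditioning on the past: the \<open>k\<close>-th sample may be
  replaced by a fresh copy of sample 0 while the state stays fixed. Independence makes the joint law
  a product, Tonelli iterates the integral, and identical distribution exchanges the
  samples.\<close>

lemma nn_integral_iterates:
  assumes it: "scgd_iterates M w v X fv gw dg \<alpha> \<beta> x0 y0 x y" and x0: "x0 \<in> X"
    and q: "q \<in> borel_measurable (state_space \<Otimes>\<^sub>M (MW \<Otimes>\<^sub>M MV))"
  shows "(\<lambda>\<omega>. (x k \<omega>, y k \<omega>)) \<in> measurable M state_space"
    and "(\<integral>\<^sup>+\<omega>. q ((x k \<omega>, y k \<omega>), (w k \<omega>, v k \<omega>)) \<partial>M)
      = (\<integral>\<^sup>+\<omega>. \<integral>\<^sup>+\<omega>'. q ((x k \<omega>, y k \<omega>), (w 0 \<omega>', v 0 \<omega>')) \<partial>M \<partial>M)"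
proof -
  let ?N = "MW \<Otimes>\<^sub>M MV" and ?Z = "\<lambda>i \<omega>. (w i \<omega>, v i \<omega>)" and ?p = "\<lambda>\<omega>. (x k \<omega>, y k \<omega>)"
  let ?P = "\<lambda>\<omega>. path \<alpha> \<beta> x0 y0 k (\<lambda>i. ?Z i \<omega>)"
  let ?M1 = "PiM {..<k} (\<lambda>_. ?N)" and ?R1 = "\<lambda>\<omega>. restrict (\<lambda>i. ?Z i \<omega>) {..<k}"
  \<comment> \<open>The single sample appears as a one-element family because
    \<open>indep_var_restrict\<close> compares families over disjoint index sets.\<close>
  let ?M2 = "PiM {k} (\<lambda>_. ?N)" and ?R2 = "\<lambda>\<omega>. restrict (\<lambda>i. ?Z i \<omega>) {k}"
  note [measurable] = q path_measurable[OF x0] wv_measurable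
  have comp[measurable]: "(\<lambda>z. z k) \<in> measurable ?M2 ?N"
    by (rule measurable_component_singleton) simp
  have "indep_var ?M1 ?R1 ?M2 ?R2"
    by (rule indep_var_restrict[OF indep]) auto
  then have R[measurable]: "?R1 \<in> measurable M ?M1" "?R2 \<in> measurable M ?M2"
    and eq: "distr M ?M1 ?R1 \<Otimes>\<^sub>M distr M ?M2 ?R2 = distr M (?M1 \<Otimes>\<^sub>M ?M2) (\<lambda>\<omega>. (?R1 \<omega>, ?R2 \<omega>))"
    unfolding indep_var_distribution_eq by auto
  have P_R1: "path \<alpha> \<beta> x0 y0 k (?R1 \<omega>) = ?P \<omega>" for \<omega>
    by (intro path_cong) simp
  have pP: "?p \<omega> = path \<alpha> \<beta> x0 y0 k (?R1 \<omega>)" if "\<omega> \<in> space M" for \<omega>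
    using iterates_eq_path[OF it that] P_R1 by simp
  have "(\<lambda>\<omega>. path \<alpha> \<beta> x0 y0 k (?R1 \<omega>)) \<in> measurable M state_space"
    by (rule measurable_compose[OF R(1) path_measurable[OF x0]])
  then show p_meas: "?p \<in> measurable M state_space"
    using pP by (subst measurable_cong)
  interpret R2: prob_space "distr M ?M2 ?R2" by (rule prob_space_distr) simp
  let ?q = "\<lambda>(z, z'). q (path \<alpha> \<beta> x0 y0 k z, z' k)"
  have [measurable]: "?q \<in> borel_measurable (?M1 \<Otimes>\<^sub>M ?M2)" by measurable
  have "(\<integral>\<^sup>+\<omega>. q (?p \<omega>, ?Z k \<omega>) \<partial>M) = (\<integral>\<^sup>+\<omega>. ?q (?R1 \<omega>, ?R2 \<omega>) \<partial>M)"
    using pP by (intro nn_integral_cong) simp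
  also have "\<dots> = integral\<^sup>N (distr M (?M1 \<Otimes>\<^sub>M ?M2) (\<lambda>\<omega>. (?R1 \<omega>, ?R2 \<omega>))) ?q"
    by (rule nn_integral_distr[symmetric]) measurable
  also have "\<dots> = (\<integral>\<^sup>+z. \<integral>\<^sup>+z'. ?q (z, z') \<partial>distr M ?M2 ?R2 \<partial>distr M ?M1 ?R1)"
    unfolding eq[symmetric] by (rule R2.nn_integral_fst[symmetric]) simp
  also have "\<dots> = (\<integral>\<^sup>+\<omega>. \<integral>\<^sup>+z'. ?q (?R1 \<omega>, z') \<partial>distr M ?M2 ?R2 \<partial>M)"
    by (rule nn_integral_distr) measurable
  also have "\<dots> = (\<integral>\<^sup>+\<omega>. \<integral>\<^sup>+\<omega>'. q (?p \<omega>, ?Z 0 \<omega>') \<partial>M \<partial>M)"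
  proof (rule nn_integral_cong)
    fix \<omega> assume \<omega>: "\<omega> \<in> space M"
    have sp: "?R1 \<omega> \<in> space ?M1" "?p \<omega> \<in> space state_space"
      using measurable_space[OF R(1) \<omega>] measurable_space[OF p_meas \<omega>] by auto
    have q'[measurable]: "(\<lambda>z. q (?p \<omega>, z)) \<in> borel_measurable ?N"
      by (rule measurable_compose[OF measurable_Pair1'[OF sp(2)] q])
    have "(\<integral>\<^sup>+z'. ?q (?R1 \<omega>, z') \<partial>distr M ?M2 ?R2) = (\<integral>\<^sup>+z'. q (?p \<omega>, z' k) \<partial>distr M ?M2 ?R2)"
      using pP[OF \<omega>] by simp
    also have "\<dots> = (\<integral>\<^sup>+\<omega>'. q (?p \<omega>, ?Z k \<omega>') \<partial>M)"
      by (subst nn_integral_distr) auto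
    also have "\<dots> = (\<integral>\<^sup>+z. q (?p \<omega>, z) \<partial>distr M ?N (?Z k))"
      by (rule nn_integral_distr[OF wv_measurable, symmetric]) (simp add: q')
    also have "\<dots> = (\<integral>\<^sup>+\<omega>'. q (?p \<omega>, ?Z 0 \<omega>') \<partial>M)"
      unfolding ident[of k] by (rule nn_integral_distr[OF wv_measurable]) (simp add: q')
    finally show "(\<integral>\<^sup>+z'. ?q (?R1 \<omega>, z') \<partial>distr M ?M2 ?R2) = (\<integral>\<^sup>+\<omega>'. q (?p \<omega>, ?Z 0 \<omega>') \<partial>M)" .
  qed
  finally show "(\<integral>\<^sup>+\<omega>. q (?p \<omega>, ?Z k \<omega>) \<partial>M) = (\<integral>\<^sup>+\<omega>. \<integral>\<^sup>+\<omega>'. q (?p \<omega>, ?Z 0 \<omega>') \<partial>M \<partial>M)" .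
qed

lemma state_fst_measurable[measurable]:
  "(\<lambda>p. fst (fst p)) \<in> borel_measurable (state_space \<Otimes>\<^sub>M N)"
  by (rule from_restrict_X) measurable

end

subsection \<open>Convergence rate\<close>

text \<open>The three decisive powers occur in \<open>rate_bound\<close> with coefficients at least
  this minimum and the remaining terms are nonnegative. Hence an estimate by the bare powers becomes
  one by \<open>rate_bound\<close>.\<close>

lemma rate_bound_ge:
  assumes "0 < Cg" "0 < Cf" "0 < Vg" "0 < Dx + Dy"
  shows "min ((1 + Lf\<^sup>2 * Cg\<^sup>2) * (Dx + Dy)) Vg
      * (real k powr (a - 1) + real k powr (b - a) + real k powr (a - 2 * b))
    \<le> rate_bound Cg Cf Vg Lf Dx Dy a b k"
proof -
  let ?p = "(1 + Lf\<^sup>2 * Cg\<^sup>2) * (Dx + Dy)"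
  have "min ?p Vg * (real k powr (a - 1) + real k powr (b - a) + real k powr (a - 2 * b))
      = min ?p Vg * (real k powr (a - 1) + real k powr (b - a)) + min ?p Vg * real k powr (a - 2 * b)"
    by (simp add: distrib_left)
  also have "\<dots> \<le> ?p * (real k powr (a - 1) + real k powr (b - a)) + Vg * real k powr (a - 2 * b)"
    by (intro add_mono mult_right_mono) auto
  also have "\<dots> \<le> rate_bound Cg Cf Vg Lf Dx Dy a b k"
    using assms by (simp add: rate_bound_def)
  finally show ?thesis .
qed

lemma min_rate_coefficient_pos:
  "0 < Vg \<Longrightarrow> 0 < Dx + Dy \<Longrightarrow> 0 < min ((1 + Lf\<^sup>2 * Cg\<^sup>2) * (Dx + Dy)) (Vg :: real)"
  by (simp add: add_pos_nonneg)

text \<open>Here the exponents \<open>a - 1\<close>, \<open>b - a\<close> and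
  \<open>a - 2 * b\<close> all equal \<open>-1/4\<close>. The factor 2 arises because the first
  coefficient multiplies two of these powers.\<close>

lemma rate_bound_optimal_eq:
  "rate_bound Cg Cf Vg Lf Dx Dy (3/4) (1/2) k
    = (2 * ((1 + Lf\<^sup>2 * Cg\<^sup>2) * (Dx + Dy)) + Vg + Cg\<^sup>2 * Cf) / real k powr (1/4)
      + Cf * Cg / real k powr (3/4)"
proof -
  have "real k powr (3/4 - 1) = 1 / real k powr (1/4)" "real k powr (1/2 - 3/4) = 1 / real k powr (1/4)"
    "real k powr (3/4 - 2 * (1/2)) = 1 / real k powr (1/4)" "real k powr (- (3/4)) = 1 / real k powr (3/4)"
    by (simp_all add: powr_minus_divide[symmetric])
  then show ?thesis
    unfolding rate_bound_def by (simp only:) (simp add: algebra_simps add_divide_distrib)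
qed

lemma rate_bound_optimal:
  assumes pos: "0 < Cg" "0 < Cf" "0 < Vg" "0 < Dx" "0 < Dy"
  shows "rate_bound Cg Cf Vg Lf Dx Dy (3/4) (1/2) \<in> O(rate_bound Cg Cf Vg Lf Dx Dy a b)"
proof -
  let ?p = "(1 + Lf\<^sup>2 * Cg\<^sup>2) * (Dx + Dy)"
  \<comment> \<open>\<open>?C\<close> sums the coefficients at the optimal exponents, which bounds
    everything by \<open>k^(-1/4)\<close> since \<open>k^(-3/4)\<close> is smaller;
    \<open>?m\<close> is the coefficient of \<open>rate_bound_ge\<close>.\<close>
  let ?C = "2 * ?p + Vg + Cg\<^sup>2 * Cf + Cf * Cg" and ?m = "min ?p Vg"
  have C: "0 \<le> ?C" using pos by (simp add: add_nonneg_nonneg)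
  have m: "0 < ?m" using pos by (intro min_rate_coefficient_pos) auto
  have "norm (rate_bound Cg Cf Vg Lf Dx Dy (3/4) (1/2) k)
      \<le> ?C / ?m * norm (rate_bound Cg Cf Vg Lf Dx Dy a b k)" if k: "k \<ge> 1" for k
  proof -
    let ?s = "real k powr (a - 1) + real k powr (b - a) + real k powr (a - 2 * b)"
    have "1 / real k powr (1/4) \<le> ?s"
    proof -
      text \<open>The exponents satisfy \<open>(a - 1) + 2 (b - a) + (a - 2 b) = -1\<close>, so the largest of them
        is at least \<open>-1/4\<close>.\<close>
      have "\<not> (a - 1 < - (1/4) \<and> b - a < - (1/4) \<and> a - 2 * b < - (1/4))" by argo
      then have "- (1/4) \<le> a - 1 \<or> - (1/4) \<le> b - a \<or> - (1/4) \<le> a - 2 * b"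
        by (simp only: de_Morgan_conj not_less)
      moreover have "real k powr - (1/4) \<le> real k powr e" if "- (1/4) \<le> e" for e
        using that k by (intro powr_mono) auto
      ultimately have "real k powr - (1/4) \<le> real k powr (a - 1) \<or> real k powr - (1/4) \<le> real k powr (b - a)
          \<or> real k powr - (1/4) \<le> real k powr (a - 2 * b)" by blast
      moreover have "0 \<le> real k powr (a - 1)" "0 \<le> real k powr (b - a)" "0 \<le> real k powr (a - 2 * b)"
        by auto
      ultimately have "real k powr - (1/4) \<le> ?s" by linarith
      then show ?thesis by (simp add: powr_minus_divide)
    qed
    then have "?m * (1 / real k powr (1/4)) \<le> ?m * ?s"
      using m by (intro mult_left_mono) auto
    also have "\<dots> \<le> rate_bound Cg Cf Vg Lf Dx Dy a b k"
      using pos by (intro rate_bound_ge) auto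
    finally have lower: "1 / real k powr (1/4) \<le> rate_bound Cg Cf Vg Lf Dx Dy a b k / ?m"
      using m by (simp add: pos_le_divide_eq mult.commute)
    have nonneg: "0 \<le> rate_bound Cg Cf Vg Lf Dx Dy a' b' k" for a' b'
      using pos unfolding rate_bound_def by (intro add_nonneg_nonneg mult_nonneg_nonneg) auto
    have "Cf * Cg / real k powr (3/4) \<le> Cf * Cg / real k powr (1/4)"
      using pos k by (intro divide_left_mono powr_mono) auto
    then have "rate_bound Cg Cf Vg Lf Dx Dy (3/4) (1/2) k \<le> ?C * (1 / real k powr (1/4))"
      unfolding rate_bound_optimal_eq by (simp add: add_divide_distrib)
    also have "\<dots> \<le> ?C * (rate_bound Cg Cf Vg Lf Dx Dy a b k / ?m)"
      by (intro mult_left_mono lower C)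
    finally show ?thesis using nonneg[of "3/4" "1/2"] nonneg[of a b] by simp
  qed
  then show ?thesis
    by (intro bigoI[where c = "?C / ?m"]) (auto simp: eventually_sequentially)
qed

text \<open>Here \<open>s\<close> is the old tracking error and \<open>d\<close> the drift of its
  target. One of the two factors \<open>1 - \<beta>\<close> pays for the drift at price
  \<open>1 / \<beta>\<close>; the difference of the two sides contains a complete square, a form
  that also covers \<open>\<beta> = 1\<close>.\<close>

lemma contraction_young:
  fixes \<beta> s d :: real
  assumes "0 < \<beta>" "\<beta> \<le> 1"
  shows "(1 - \<beta>)\<^sup>2 * (s + d)\<^sup>2 \<le> (1 - \<beta>) * s\<^sup>2 + d\<^sup>2 / \<beta>"
proof -
  have "(1 - \<beta>) * s\<^sup>2 + (1 - \<beta>)\<^sup>2 * d\<^sup>2 / \<beta> - (1 - \<beta>)\<^sup>2 * (s + d)\<^sup>2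
      = \<beta> * (1 - \<beta>) * (s - (1 - \<beta>) * d / \<beta>)\<^sup>2"
    using assms(1) by (simp add: field_simps power2_eq_square)
  moreover have "0 \<le> \<beta> * (1 - \<beta>) * (s - (1 - \<beta>) * d / \<beta>)\<^sup>2"
    using assms by simp
  moreover have "(1 - \<beta>)\<^sup>2 * d\<^sup>2 / \<beta> \<le> 1 * d\<^sup>2 / \<beta>"
    using assms by (intro divide_right_mono mult_right_mono power_le_one) auto
  ultimately show ?thesis by simp
qed

text \<open>A run with general stepsizes and a minimizer \<open>z\<close>; the recursions are
  derived at this level, and power stepsizes enter with \<open>averaged_gap_rate\<close>.\<close>

locale scgd_run = scgd_setting M MW MV w v X f g fv gw dg Cg Cf Vg Lf
  for M :: "'a measure" and MW :: "'w measure" and MV :: "'v measure"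
    and w :: "nat \<Rightarrow> 'a \<Rightarrow> 'w" and v :: "nat \<Rightarrow> 'a \<Rightarrow> 'v"
    and X :: "(real^'n) set"
    and f :: "real^'m \<Rightarrow> real" and g :: "real^'n \<Rightarrow> real^'m"
    and fv :: "'v \<Rightarrow> real^'m \<Rightarrow> real" and gw :: "'w \<Rightarrow> real^'n \<Rightarrow> real^'m"
    and dg :: "'w \<Rightarrow> real^'n \<Rightarrow> real^'m^'n"
    and Cg Cf Vg Lf :: real +
  fixes \<alpha> \<beta> :: "nat \<Rightarrow> real" and x0 :: "real^'n" and y0 :: "real^'m"
    and x :: "nat \<Rightarrow> 'a \<Rightarrow> real^'n" and y :: "nat \<Rightarrow> 'a \<Rightarrow> real^'m"
    and z :: "real^'n" and Dx Dy :: real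
  assumes iterates: "scgd_iterates M w v X fv gw dg \<alpha> \<beta> x0 y0 x y"
    and x0_in_X: "x0 \<in> X" and \<alpha>_pos: "\<And>k. 0 < \<alpha> k" and \<beta>_pos: "\<And>k. 0 < \<beta> k" and \<beta>_le_1: "\<And>k. \<beta> k \<le> 1"
    and z_in_X: "z \<in> X" and z_min: "\<And>u. u \<in> X \<Longrightarrow> f (g z) \<le> f (g u)"
    and diameter: "\<And>u. u \<in> X \<Longrightarrow> (norm (u - z))\<^sup>2 \<le> Dx"
    and Dy_pos: "0 < Dy"
    and tracking_le: "\<And>k. (\<integral>\<^sup>+\<omega>. ennreal ((norm (y (Suc k) \<omega> - g (x k \<omega>)))\<^sup>2) \<partial>M) \<le> ennreal Dy"
begin

abbreviation F :: "real^'n \<Rightarrow> real" where "F u \<equiv> f (g u)"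

definition gap :: "nat \<Rightarrow> real" where
  "gap k = expectation (\<lambda>\<omega>. F (x k \<omega>) - F z)"

definition sqdist :: "nat \<Rightarrow> real" where
  "sqdist k = expectation (\<lambda>\<omega>. (norm (x k \<omega> - z))\<^sup>2)"

text \<open>The tracking error compares \<open>y k\<close> with the point \<open>x (k - 1)\<close> at which \<open>g\<close> was last sampled;
  only \<open>k \<ge> 1\<close> is meaningful.\<close>

definition tracking :: "nat \<Rightarrow> real" where
  "tracking k = expectation (\<lambda>\<omega>. (norm (y k \<omega> - g (x (k - 1) \<omega>)))\<^sup>2)"

section \<open>Measurability and integrability along the run\<close>

lemma F_continuous: "continuous_on UNIV F"
proof -
  have "continuous_on UNIV f"
    using f_C1(1) has_derivative_continuous unfolding gderiv_def
    by (blast intro: continuous_at_imp_continuous_on)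
  then show ?thesis
    using g_cont by (intro continuous_on_compose2[of UNIV f UNIV g]) auto
qed

lemma F_measurable[measurable]: "F \<in> borel_measurable borel"
  by (rule borel_measurable_continuous_onI[OF F_continuous])

lemma g_measurable[measurable]: "g \<in> borel_measurable borel"
  by (rule borel_measurable_continuous_onI[OF g_cont])

lemma state_measurable: "(\<lambda>\<omega>. (x k \<omega>, y k \<omega>)) \<in> measurable M state_space"
  by (rule nn_integral_iterates(1)[OF iterates x0_in_X, of "\<lambda>_. 0"]) simp

lemma x_measurable_X: "x k \<in> measurable M (restrict_space borel X)"
  using measurable_compose[OF state_measurable measurable_fst] by simp

lemma x_measurable[measurable]: "x k \<in> borel_measurable M"
  by (rule from_restrict_X[OF x_measurable_X])

lemma y_measurable[measurable]: "y k \<in> borel_measurable M"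
  using measurable_compose[OF state_measurable measurable_snd] by simp

lemma x_in_X: "\<omega> \<in> space M \<Longrightarrow> x k \<omega> \<in> X"
  using measurable_space[OF x_measurable_X] by (auto simp: space_restrict_space)

lemma iterates_Suc:
  assumes "\<omega> \<in> space M"
  shows "y (Suc k) \<omega> = upd_y (\<beta> k) (w k \<omega>) (x k \<omega>) (y k \<omega>)"
    and "x (Suc k) \<omega> = upd_x (\<alpha> k) (\<beta> k) (w k \<omega>) (v k \<omega>) (x k \<omega>) (y k \<omega>)"
  using iterates assms by (simp_all add: scgd_iterates_def upd_x_def upd_y_def direction_def)

text \<open>The source of integrability for objective values: a continuous function is bounded on
  the compact feasible set, which contains all iterates.\<close>

lemma X_compact: "compact X"
proof -
  have "norm (u - z) \<le> sqrt Dx" if "u \<in> X" for u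
    using diameter[OF that] by (rule real_le_rsqrt)
  then have "X \<subseteq> cball z (sqrt Dx)" by (auto simp: dist_norm norm_minus_commute)
  then show ?thesis
    using X_closed by (meson bounded_cball bounded_subset compact_eq_bounded_closed)
qed

lemma integrable_F:
  assumes [measurable]: "q \<in> borel_measurable M" and "\<And>\<omega>. \<omega> \<in> space M \<Longrightarrow> q \<omega> \<in> X"
  shows "integrable M (\<lambda>\<omega>. F (q \<omega>))"
proof -
  have "bounded (F ` X)"
    using F_continuous X_compact
    by (intro compact_imp_bounded compact_continuous_image) (auto intro: continuous_on_subset)
  then obtain B where B: "\<And>u. u \<in> X \<Longrightarrow> norm (F u) \<le> B" unfolding bounded_iff by blast
  show ?thesis
    using B assms(2) by (intro integrable_const_bound[of _ B]) auto
qed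

lemma Dx_nonneg: "0 \<le> Dx"
  using diameter[OF z_in_X] by simp

lemma sqdist_integrable: "integrable M (\<lambda>\<omega>. (norm (x k \<omega> - z))\<^sup>2)"
  by (rule integrable_const_bound[of _ Dx]) (auto intro!: AE_I2 diameter x_in_X)

lemma sqdist_bounds: "0 \<le> sqdist k" "sqdist k \<le> Dx"
proof -
  show "0 \<le> sqdist k" unfolding sqdist_def by (intro Bochner_Integration.integral_nonneg) simp
  have "sqdist k \<le> expectation (\<lambda>_. Dx)"
    unfolding sqdist_def using sqdist_integrable by (intro integral_mono) (auto intro: diameter x_in_X)
  then show "sqdist k \<le> Dx" by (simp add: prob_space)
qed

lemma tracking_integrable: "integrable M (\<lambda>\<omega>. (norm (y (Suc k) \<omega> - g (x k \<omega>)))\<^sup>2)"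
  using Dy_pos by (intro nonneg_integral_le_of_nn_integral_le(1)[OF _ _ _ tracking_le]) auto

lemma tracking_bounds: "0 \<le> tracking k" "k \<ge> 1 \<Longrightarrow> tracking k \<le> Dy"
proof -
  show "0 \<le> tracking k" unfolding tracking_def by (intro Bochner_Integration.integral_nonneg) simp
  show "tracking k \<le> Dy" if "k \<ge> 1"
    using Dy_pos tracking_le[of "k - 1"] that unfolding tracking_def
    by (intro nonneg_integral_le_of_nn_integral_le(2)) auto
qed

lemma gap_integrable: "integrable M (\<lambda>\<omega>. F (x k \<omega>) - F z)"
  by (intro Bochner_Integration.integrable_diff integrable_F) (auto intro: x_in_X z_in_X)

lemma gap_nonneg: "0 \<le> gap k"
  unfolding gap_def by (intro Bochner_Integration.integral_nonneg) (auto intro: z_min x_in_X)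

section \<open>The two recursions in expectation\<close>

lemma step_length:
  shows "integrable M (\<lambda>\<omega>. (norm (x (Suc k) \<omega> - x k \<omega>))\<^sup>2)"
    and "expectation (\<lambda>\<omega>. (norm (x (Suc k) \<omega> - x k \<omega>))\<^sup>2) \<le> (\<alpha> k)\<^sup>2 * (Cf * (real CARD('n) * Cg))"
proof -
  let ?q = "\<lambda>((r, r'), (s, t)). ennreal ((norm (upd_x (\<alpha> k) (\<beta> k) s t r r' - r))\<^sup>2)"
  have "(\<integral>\<^sup>+\<omega>. ennreal ((norm (x (Suc k) \<omega> - x k \<omega>))\<^sup>2) \<partial>M)
      = (\<integral>\<^sup>+\<omega>. ?q ((x k \<omega>, y k \<omega>), (w k \<omega>, v k \<omega>)) \<partial>M)"
    by (intro nn_integral_cong) (simp add: iterates_Suc)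
  also have "\<dots> = (\<integral>\<^sup>+\<omega>. \<integral>\<^sup>+\<omega>'. ?q ((x k \<omega>, y k \<omega>), (w 0 \<omega>', v 0 \<omega>')) \<partial>M \<partial>M)"
  proof (rule nn_integral_iterates(2)[OF iterates x0_in_X])
    show "?q \<in> borel_measurable (state_space \<Otimes>\<^sub>M (MW \<Otimes>\<^sub>M MV))"
      unfolding split_def by measurable
  qed
  also have "\<dots> \<le> (\<integral>\<^sup>+\<omega>. ennreal ((\<alpha> k)\<^sup>2 * (Cf * (real CARD('n) * Cg))) \<partial>M)"
  proof (rule nn_integral_mono)
    fix \<omega> assume "\<omega> \<in> space M"
    note X = x_in_X[OF this, of k]
    let ?d = "\<lambda>\<omega>'. direction (\<beta> k) (w 0 \<omega>') (v 0 \<omega>') (x k \<omega>) (y k \<omega>)"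
    have "(\<integral>\<^sup>+\<omega>'. ?q ((x k \<omega>, y k \<omega>), (w 0 \<omega>', v 0 \<omega>')) \<partial>M)
        \<le> (\<integral>\<^sup>+\<omega>'. ennreal ((\<alpha> k)\<^sup>2) * ennreal ((norm (?d \<omega>'))\<^sup>2) \<partial>M)"
    proof (rule nn_integral_mono)
      fix \<omega>'
      \<comment> \<open>The current iterate is feasible, hence fixed by the projection, so
        nonexpansiveness bounds the step by the unprojected one.\<close>
      have "norm (upd_x (\<alpha> k) (\<beta> k) (w 0 \<omega>') (v 0 \<omega>') (x k \<omega>) (y k \<omega>) - x k \<omega>) \<le> norm (\<alpha> k *\<^sub>R ?d \<omega>')"
        using closest_point_nonexpansive[OF X, of "x k \<omega> - \<alpha> k *\<^sub>R ?d \<omega>'"] by (simp add: upd_x_def)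
      then have "(norm (upd_x (\<alpha> k) (\<beta> k) (w 0 \<omega>') (v 0 \<omega>') (x k \<omega>) (y k \<omega>) - x k \<omega>))\<^sup>2 \<le> (norm (\<alpha> k *\<^sub>R ?d \<omega>'))\<^sup>2"
        by (rule power_mono) simp
      then show "?q ((x k \<omega>, y k \<omega>), (w 0 \<omega>', v 0 \<omega>')) \<le> ennreal ((\<alpha> k)\<^sup>2) * ennreal ((norm (?d \<omega>'))\<^sup>2)"
        by (simp add: power_mult_distrib ennreal_leI flip: ennreal_mult)
    qed
    also have "\<dots> = ennreal ((\<alpha> k)\<^sup>2) * (\<integral>\<^sup>+\<omega>'. ennreal ((norm (?d \<omega>'))\<^sup>2) \<partial>M)"
      using X by (intro nn_integral_cmult) measurable
    also have "\<dots> \<le> ennreal ((\<alpha> k)\<^sup>2) * ennreal (Cf * (real CARD('n) * Cg))"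
      by (intro mult_left_mono direction_second_moment X) simp
    also have "\<dots> = ennreal ((\<alpha> k)\<^sup>2 * (Cf * (real CARD('n) * Cg)))"
      using consts_pos by (intro ennreal_mult[symmetric]) auto
    finally show "(\<integral>\<^sup>+\<omega>'. ?q ((x k \<omega>, y k \<omega>), (w 0 \<omega>', v 0 \<omega>')) \<partial>M) \<le> ennreal ((\<alpha> k)\<^sup>2 * (Cf * (real CARD('n) * Cg)))" .
  qed
  also have "\<dots> = ennreal ((\<alpha> k)\<^sup>2 * (Cf * (real CARD('n) * Cg)))" by (simp add: emeasure_space_1)
  finally have le: "(\<integral>\<^sup>+\<omega>. ennreal ((norm (x (Suc k) \<omega> - x k \<omega>))\<^sup>2) \<partial>M) \<le> ennreal ((\<alpha> k)\<^sup>2 * (Cf * (real CARD('n) * Cg)))" .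
  show "integrable M (\<lambda>\<omega>. (norm (x (Suc k) \<omega> - x k \<omega>))\<^sup>2)"
    and "expectation (\<lambda>\<omega>. (norm (x (Suc k) \<omega> - x k \<omega>))\<^sup>2) \<le> (\<alpha> k)\<^sup>2 * (Cf * (real CARD('n) * Cg))"
    using consts_pos by (auto intro!: nonneg_integral_le_of_nn_integral_le[OF _ _ _ le])
qed

text \<open>Between two samplings the target \<open>g (x k)\<close> drifts by at most
  \<open>Cg\<close> times the length of a step, and \<open>step_length\<close> bounds the second
  moment of that length. The indices start at \<open>Suc k\<close> because a previous iterate is
  required.\<close>

lemma tracking_rec:
  "tracking (Suc (Suc k)) \<le> (1 - \<beta> (Suc k)) * tracking (Suc k)
     + (\<alpha> k)\<^sup>2 / \<beta> (Suc k) * (Cg\<^sup>2 * (Cf * (real CARD('n) * Cg))) + (\<beta> (Suc k))\<^sup>2 * Vg"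
proof -
  let ?k = "Suc k" and ?\<beta> = "\<beta> (Suc k)"
  let ?q = "\<lambda>((r, r'), (s, t)). ennreal ((norm (upd_y ?\<beta> s r r' - g r))\<^sup>2)"
  let ?b = "\<lambda>\<omega>. (1 - ?\<beta>) * (norm (y ?k \<omega> - g (x k \<omega>)))\<^sup>2
      + Cg\<^sup>2 / ?\<beta> * (norm (x ?k \<omega> - x k \<omega>))\<^sup>2 + ?\<beta>\<^sup>2 * Vg"
  note \<beta> = \<beta>_pos[of ?k] \<beta>_le_1[of ?k]
  have b_nonneg: "0 \<le> ?b \<omega>" for \<omega>
    using \<beta> consts_pos by (intro add_nonneg_nonneg mult_nonneg_nonneg) auto
  have b_int: "integrable M ?b"
    using tracking_integrable[of k] step_length(1)[of k] by simp
  have "(\<integral>\<^sup>+\<omega>. ennreal ((norm (y (Suc ?k) \<omega> - g (x ?k \<omega>)))\<^sup>2) \<partial>M)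
      = (\<integral>\<^sup>+\<omega>. ?q ((x ?k \<omega>, y ?k \<omega>), (w ?k \<omega>, v ?k \<omega>)) \<partial>M)"
    by (intro nn_integral_cong) (simp add: iterates_Suc(1)[of _ "Suc k"])
  also have "\<dots> = (\<integral>\<^sup>+\<omega>. \<integral>\<^sup>+\<omega>'. ?q ((x ?k \<omega>, y ?k \<omega>), (w 0 \<omega>', v 0 \<omega>')) \<partial>M \<partial>M)"
  proof (rule nn_integral_iterates(2)[OF iterates x0_in_X])
    show "?q \<in> borel_measurable (state_space \<Otimes>\<^sub>M (MW \<Otimes>\<^sub>M MV))"
      unfolding split_def by measurable
  qed
  also have "\<dots> \<le> (\<integral>\<^sup>+\<omega>. ennreal (?b \<omega>) \<partial>M)"
  proof (rule nn_integral_mono)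
    fix \<omega> assume \<omega>: "\<omega> \<in> space M"
    note X = x_in_X[OF \<omega>, of ?k]
    have "(\<integral>\<^sup>+\<omega>'. ?q ((x ?k \<omega>, y ?k \<omega>), (w 0 \<omega>', v 0 \<omega>')) \<partial>M)
        = ennreal (expectation (\<lambda>\<omega>'. (norm (upd_y ?\<beta> (w 0 \<omega>') (x ?k \<omega>) (y ?k \<omega>) - g (x ?k \<omega>)))\<^sup>2))"
      using nn_integral_eq_integral[OF tracking_step(1)[OF X]] by simp
    also have "\<dots> \<le> ennreal (?b \<omega>)"
    proof (rule ennreal_leI)
      let ?s = "norm (y ?k \<omega> - g (x k \<omega>))" and ?d = "norm (x ?k \<omega> - x k \<omega>)"
      have "norm (y ?k \<omega> - g (x ?k \<omega>)) \<le> ?s + Cg * ?d"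
        using norm_triangle_ineq[of "y ?k \<omega> - g (x k \<omega>)" "g (x k \<omega>) - g (x ?k \<omega>)"]
          lipschitz_onD[OF g_lipschitz, of "x k \<omega>" "x ?k \<omega>"]
        by (simp add: dist_norm norm_minus_commute)
      then have "(1 - ?\<beta>)\<^sup>2 * (norm (y ?k \<omega> - g (x ?k \<omega>)))\<^sup>2 \<le> (1 - ?\<beta>)\<^sup>2 * (?s + Cg * ?d)\<^sup>2"
        by (intro mult_left_mono power_mono) auto
      also have "\<dots> \<le> (1 - ?\<beta>) * ?s\<^sup>2 + (Cg * ?d)\<^sup>2 / ?\<beta>"
        using \<beta> by (rule contraction_young)
      finally show "expectation (\<lambda>\<omega>'. (norm (upd_y ?\<beta> (w 0 \<omega>') (x ?k \<omega>) (y ?k \<omega>) - g (x ?k \<omega>)))\<^sup>2) \<le> ?b \<omega>"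
        using tracking_step(2)[OF X, of ?\<beta> "y ?k \<omega>"] by (simp add: power_mult_distrib)
    qed
    finally show "(\<integral>\<^sup>+\<omega>'. ?q ((x ?k \<omega>, y ?k \<omega>), (w 0 \<omega>', v 0 \<omega>')) \<partial>M) \<le> ennreal (?b \<omega>)" .
  qed
  also have "\<dots> = ennreal (expectation ?b)"
    using b_nonneg by (intro nn_integral_eq_integral b_int) auto
  finally have "(\<integral>\<^sup>+\<omega>. ennreal ((norm (y (Suc ?k) \<omega> - g (x ?k \<omega>)))\<^sup>2) \<partial>M) \<le> ennreal (expectation ?b)" .
  then have "tracking (Suc ?k) \<le> expectation ?b"
    using Bochner_Integration.integral_nonneg[OF b_nonneg, of M] unfolding tracking_def
    by (intro nonneg_integral_le_of_nn_integral_le(2)) auto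
  also have "\<dots> = (1 - ?\<beta>) * tracking ?k
      + Cg\<^sup>2 / ?\<beta> * expectation (\<lambda>\<omega>. (norm (x ?k \<omega> - x k \<omega>))\<^sup>2) + ?\<beta>\<^sup>2 * Vg"
    using tracking_integrable[of k] step_length(1)[of k] by (simp add: prob_space tracking_def)
  also have "\<dots> \<le> (1 - ?\<beta>) * tracking ?k
      + Cg\<^sup>2 / ?\<beta> * ((\<alpha> k)\<^sup>2 * (Cf * (real CARD('n) * Cg))) + ?\<beta>\<^sup>2 * Vg"
    using step_length(2)[of k] \<beta> by (intro add_mono mult_left_mono) auto
  finally show ?thesis by (simp add: mult_ac)
qed

lemma descent_rec:
  "sqdist (Suc k) + 2 * \<alpha> k * gap k
    \<le> sqdist k + (\<alpha> k)\<^sup>2 * (Cf * (real CARD('n) * Cg))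
      + (\<alpha> k)\<^sup>2 / \<beta> k * (Lf\<^sup>2 * Dx * (real CARD('n) * Cg)) + \<beta> k * tracking (Suc k)"
proof -
  let ?c = "(\<alpha> k)\<^sup>2 * (Cf * (real CARD('n) * Cg)) + (\<alpha> k)\<^sup>2 / \<beta> k * (Lf\<^sup>2 * Dx * (real CARD('n) * Cg))"
  \<comment> \<open>With the gap on the left and the tracking error on the right, both sides are
    nonnegative at feasible states, the gap because \<open>z\<close> is a minimizer. This permits
    nonnegative integrals throughout.\<close>
  let ?q1 = "\<lambda>((r, r'), (s, t)). ennreal ((norm (upd_x (\<alpha> k) (\<beta> k) s t r r' - z))\<^sup>2 + 2 * \<alpha> k * (F r - F z))"
  let ?q2 = "\<lambda>((r, r'), (s, t)). ennreal ((norm (r - z))\<^sup>2 + ?c + \<beta> k * (norm (upd_y (\<beta> k) s r r' - g r))\<^sup>2)"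
  let ?A = "\<lambda>\<omega>. (norm (x (Suc k) \<omega> - z))\<^sup>2 + 2 * \<alpha> k * (F (x k \<omega>) - F z)"
  let ?B = "\<lambda>\<omega>. (norm (x k \<omega> - z))\<^sup>2 + ?c + \<beta> k * (norm (y (Suc k) \<omega> - g (x k \<omega>)))\<^sup>2"
  note ab = \<alpha>_pos[of k] \<beta>_pos[of k] \<beta>_le_1[of k]
  have c: "0 \<le> ?c"
    using ab consts_pos Dx_nonneg by (intro add_nonneg_nonneg mult_nonneg_nonneg) auto
  have A_nonneg: "AE \<omega> in M. 0 \<le> ?A \<omega>"
    using z_min x_in_X ab by (intro AE_I2 add_nonneg_nonneg mult_nonneg_nonneg) auto
  have B_nonneg: "0 \<le> ?B \<omega>" for \<omega>
    using ab by (intro add_nonneg_nonneg[OF add_nonneg_nonneg[OF _ c]]) auto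
  have A_int: "integrable M ?A"
    using sqdist_integrable gap_integrable by simp
  have B_int: "integrable M ?B"
    using sqdist_integrable tracking_integrable by simp
  have "ennreal (expectation ?A) = (\<integral>\<^sup>+\<omega>. ennreal (?A \<omega>) \<partial>M)"
    by (rule nn_integral_eq_integral[OF A_int A_nonneg, symmetric])
  also have "\<dots> = (\<integral>\<^sup>+\<omega>. ?q1 ((x k \<omega>, y k \<omega>), (w k \<omega>, v k \<omega>)) \<partial>M)"
    by (intro nn_integral_cong) (simp add: iterates_Suc(2))
  also have "\<dots> = (\<integral>\<^sup>+\<omega>. \<integral>\<^sup>+\<omega>'. ?q1 ((x k \<omega>, y k \<omega>), (w 0 \<omega>', v 0 \<omega>')) \<partial>M \<partial>M)"
  proof (rule nn_integral_iterates(2)[OF iterates x0_in_X])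
    show "?q1 \<in> borel_measurable (state_space \<Otimes>\<^sub>M (MW \<Otimes>\<^sub>M MV))"
      unfolding split_def by measurable
  qed
  also have "\<dots> \<le> (\<integral>\<^sup>+\<omega>. \<integral>\<^sup>+\<omega>'. ?q2 ((x k \<omega>, y k \<omega>), (w 0 \<omega>', v 0 \<omega>')) \<partial>M \<partial>M)"
  proof (rule nn_integral_mono)
    fix \<omega> assume \<omega>: "\<omega> \<in> space M"
    let ?x = "x k \<omega>" and ?y = "y k \<omega>"
    note X[measurable] = x_in_X[OF \<omega>, of k]
    let ?f1 = "\<lambda>\<omega>'. (norm (upd_x (\<alpha> k) (\<beta> k) (w 0 \<omega>') (v 0 \<omega>') ?x ?y - z))\<^sup>2"
    let ?f2 = "\<lambda>\<omega>'. (norm (upd_y (\<beta> k) (w 0 \<omega>') ?x ?y - g ?x))\<^sup>2"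
    have f1: "integrable M ?f1"
      by (intro integrable_const_bound[where B = Dx]) (auto intro!: diameter upd_x_in_X)
    note f2 = tracking_step(1)[OF X, of "\<beta> k" ?y]
    have F: "0 \<le> 2 * \<alpha> k * (F ?x - F z)" using z_min[OF X] ab by simp
    have "(\<integral>\<^sup>+\<omega>'. ?q1 ((?x, ?y), (w 0 \<omega>', v 0 \<omega>')) \<partial>M)
        = ennreal (expectation (\<lambda>\<omega>'. ?f1 \<omega>' + 2 * \<alpha> k * (F ?x - F z)))"
      using f1 F by (subst nn_integral_eq_integral[symmetric]) auto
    also have "\<dots> \<le> ennreal (expectation (\<lambda>\<omega>'. (norm (?x - z))\<^sup>2 + ?c + \<beta> k * ?f2 \<omega>'))"
      using descent_step[OF X z_in_X ab(1,2) diameter, of ?y] f1 f2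
      by (intro ennreal_leI) (simp add: prob_space)
    also have "\<dots> = (\<integral>\<^sup>+\<omega>'. ?q2 ((?x, ?y), (w 0 \<omega>', v 0 \<omega>')) \<partial>M)"
      using f2 c ab by (subst nn_integral_eq_integral[symmetric]) (auto intro!: AE_I2 add_nonneg_nonneg[OF add_nonneg_nonneg[OF _ c]])
    finally show "(\<integral>\<^sup>+\<omega>'. ?q1 ((?x, ?y), (w 0 \<omega>', v 0 \<omega>')) \<partial>M)
        \<le> (\<integral>\<^sup>+\<omega>'. ?q2 ((?x, ?y), (w 0 \<omega>', v 0 \<omega>')) \<partial>M)" .
  qed
  \<comment> \<open>The exchange of samples is now undone, so that \<open>upd_y\<close> becomes the
    actual \<open>y (Suc k)\<close> and its error becomes \<open>tracking (Suc k)\<close>.\<close>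
  also have "\<dots> = (\<integral>\<^sup>+\<omega>. ?q2 ((x k \<omega>, y k \<omega>), (w k \<omega>, v k \<omega>)) \<partial>M)"
  proof (rule nn_integral_iterates(2)[OF iterates x0_in_X, symmetric])
    show "?q2 \<in> borel_measurable (state_space \<Otimes>\<^sub>M (MW \<Otimes>\<^sub>M MV))"
      unfolding split_def by measurable
  qed
  also have "\<dots> = (\<integral>\<^sup>+\<omega>. ennreal (?B \<omega>) \<partial>M)"
    by (intro nn_integral_cong) (simp add: iterates_Suc(1))
  also have "\<dots> = ennreal (expectation ?B)"
    using B_nonneg by (intro nn_integral_eq_integral B_int) auto
  finally have "expectation ?A \<le> expectation ?B"
    using Bochner_Integration.integral_nonneg[OF B_nonneg, of M] by simp
  moreover have "expectation ?A = sqdist (Suc k) + 2 * \<alpha> k * gap k"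
    using sqdist_integrable gap_integrable
    by (subst Bochner_Integration.integral_add) (auto simp: sqdist_def gap_def)
  moreover have "expectation ?B = sqdist k + ?c + \<beta> k * tracking (Suc k)"
    using sqdist_integrable tracking_integrable by (simp add: prob_space sqdist_def tracking_def)
  ultimately show ?thesis by simp
qed

section \<open>The averaged iterate\<close>

lemma averaged_iterate_in_X:
  assumes "k \<ge> 1" "\<omega> \<in> space M"
  shows "averaged_iterate x k \<omega> \<in> X"
  unfolding averaged_iterate_def scaleR_sum_right
  using window_bounds(1,2)[OF assms(1)] X_convex x_in_X[OF assms(2)]
  by (intro convex_sum) auto

lemma averaged_gap_integrable:
  assumes "k \<ge> 1"
  shows "integrable M (\<lambda>\<omega>. F (averaged_iterate x k \<omega>) - F z)"
proof (intro Bochner_Integration.integrable_diff integrable_F)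
  show "averaged_iterate x k \<in> borel_measurable M"
    unfolding averaged_iterate_def[abs_def] by measurable
qed (auto intro: averaged_iterate_in_X assms z_in_X)

text \<open>Jensen's inequality with uniform weights. The lower bound serves the absolute value in
  \<open>is_bigO\<close> and rests on the average being feasible.\<close>

lemma averaged_gap_bounds:
  assumes conv: "convex_on UNIV F" and k: "k \<ge> 1"
  shows "0 \<le> expectation (\<lambda>\<omega>. F (averaged_iterate x k \<omega>) - F z)"
    and "expectation (\<lambda>\<omega>. F (averaged_iterate x k \<omega>) - F z)
      \<le> (\<Sum>t=k - window k + 1..k. gap t) / real (window k)"
proof -
  let ?I = "{k - window k + 1..k}" and ?N = "real (window k)"
  note wb = window_bounds(1,2)[OF k]
  have N: "0 < ?N" and card: "real (card ?I) = ?N" using wb by auto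
  show "0 \<le> expectation (\<lambda>\<omega>. F (averaged_iterate x k \<omega>) - F z)"
    by (intro Bochner_Integration.integral_nonneg_AE AE_I2)
      (auto intro: z_min averaged_iterate_in_X[OF k])
  have "F (averaged_iterate x k \<omega>) - F z \<le> (\<Sum>t\<in>?I. (1 / ?N) * (F (x t \<omega>) - F z))" for \<omega>
  proof -
    have "F (averaged_iterate x k \<omega>) \<le> (\<Sum>t\<in>?I. (1 / ?N) * F (x t \<omega>))"
      unfolding averaged_iterate_def scaleR_sum_right
      using wb card N by (intro convex_on_sum[OF _ _ conv]) auto
    moreover have "(\<Sum>t\<in>?I. (1 / ?N) * (F (x t \<omega>) - F z)) = (\<Sum>t\<in>?I. (1 / ?N) * F (x t \<omega>)) - F z"
      using N card by (simp add: right_diff_distrib sum_subtractf)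
    ultimately show ?thesis by simp
  qed
  then have "expectation (\<lambda>\<omega>. F (averaged_iterate x k \<omega>) - F z)
      \<le> expectation (\<lambda>\<omega>. \<Sum>t\<in>?I. (1 / ?N) * (F (x t \<omega>) - F z))"
    using averaged_gap_integrable[OF k] gap_integrable
    by (intro integral_mono Bochner_Integration.integrable_sum integrable_mult_right) auto
  also have "\<dots> = (\<Sum>t\<in>?I. (1 / ?N) * gap t)"
    unfolding gap_def using gap_integrable by (subst Bochner_Integration.integral_sum) auto
  finally show "expectation (\<lambda>\<omega>. F (averaged_iterate x k \<omega>) - F z) \<le> (\<Sum>t\<in>?I. gap t) / ?N"
    by (simp add: sum_divide_distrib)
qed

lemma averaged_gap_rate:
  assumes conv: "convex_on UNIV F" and Dx: "0 < Dx"
    and a: "0 < a" "a < 1" and b: "0 < b" "b < 1" and \<alpha>0: "\<alpha> 0 \<le> 1"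
    and \<alpha>: "\<And>k. k \<ge> 1 \<Longrightarrow> \<alpha> k = real k powr (- a)" and \<beta>: "\<And>k. k \<ge> 1 \<Longrightarrow> \<beta> k = real k powr (- b)"
  shows "is_bigO (\<lambda>k. expectation (\<lambda>\<omega>. F (averaged_iterate x k \<omega>) - F z)) (rate_bound Cg Cf Vg Lf Dx Dy a b)"
proof -
  let ?n = "real CARD('n)"
  let ?s = "\<lambda>k. real k powr (a - 1) + real k powr (b - a) + real k powr (a - 2 * b)"
  define m where "m = min ((1 + Lf\<^sup>2 * Cg\<^sup>2) * (Dx + Dy)) Vg"
  have "\<exists>c>0. \<forall>k\<ge>1. (\<Sum>t=k - window k + 1..k. gap t) / real (window k) \<le> c * ?s k"
  proof (rule scgd_recursion_rate[OF a b _ \<alpha> \<beta> sqdist_bounds tracking_bounds gap_nonneg])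
    show "\<alpha> 0 \<in> {0<..1}" using \<alpha>0 \<alpha>_pos by simp
    show "sqdist (Suc k) + 2 * \<alpha> k * gap k \<le> sqdist k + (\<alpha> k)\<^sup>2 * (Cf * (?n * Cg))
      + (\<alpha> k)\<^sup>2 / \<beta> k * (Lf\<^sup>2 * Dx * (?n * Cg)) + \<beta> k * tracking (Suc k)" for k
      by (rule descent_rec)
    show "tracking (Suc k) \<le> (1 - \<beta> k) * tracking k
      + (\<alpha> (k - 1))\<^sup>2 / \<beta> k * (Cg\<^sup>2 * (Cf * (?n * Cg))) + (\<beta> k)\<^sup>2 * Vg" if "k \<ge> 1" for k
      using tracking_rec[of "k - 1"] that by simp
  qed (use consts_pos Dx Dy_pos in auto)
  then obtain c where c: "0 < c"
    "\<And>k. k \<ge> 1 \<Longrightarrow> (\<Sum>t=k - window k + 1..k. gap t) / real (window k) \<le> c * ?s k" by blast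
  have m: "0 < m" unfolding m_def using consts_pos Dx Dy_pos by (intro min_rate_coefficient_pos) auto
  have "\<bar>expectation (\<lambda>\<omega>. F (averaged_iterate x k \<omega>) - F z)\<bar> \<le> c / m * \<bar>rate_bound Cg Cf Vg Lf Dx Dy a b k\<bar>"
    if k: "k \<ge> 1" for k
  proof -
    have "\<bar>expectation (\<lambda>\<omega>. F (averaged_iterate x k \<omega>) - F z)\<bar> \<le> c / m * (m * ?s k)"
      using averaged_gap_bounds[OF conv k] c(2)[OF k] m by simp
    also have "\<dots> \<le> c / m * \<bar>rate_bound Cg Cf Vg Lf Dx Dy a b k\<bar>"
      using consts_pos Dx Dy_pos c(1) m unfolding m_def
      by (intro mult_left_mono order_trans[OF rate_bound_ge abs_ge_self]) auto
    finally show ?thesis .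
  qed
  then show ?thesis unfolding is_bigO_def using c(1) m by (intro exI[of _ "c / m"]) auto
qed

end


theorem theorem6:
  fixes M :: "'a measure" and MW :: "'w measure" and MV :: "'v measure"
    and w :: "nat \<Rightarrow> 'a \<Rightarrow> 'w" and v :: "nat \<Rightarrow> 'a \<Rightarrow> 'v"
    and X :: "(real^'n) set"
    and f :: "real^'m \<Rightarrow> real" and g :: "real^'n \<Rightarrow> real^'m"
    and fv :: "'v \<Rightarrow> real^'m \<Rightarrow> real" and gw :: "'w \<Rightarrow> real^'n \<Rightarrow> real^'m"
    and dg :: "'w \<Rightarrow> real^'n \<Rightarrow> real^'m^'n"
    and Cg Cf Vg Lf Dx Dy a b :: real
    and F :: "real^'n \<Rightarrow> real" and xstar :: "real^'n"
    and \<alpha> \<beta> :: "nat \<Rightarrow> real" and x0 :: "real^'n" and y0 :: "real^'m"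
    and x :: "nat \<Rightarrow> 'a \<Rightarrow> real^'n" and y :: "nat \<Rightarrow> 'a \<Rightarrow> real^'m"
  assumes "scgd_setting M MW MV w v X f g fv gw dg Cg Cf Vg Lf"
    and "F = (\<lambda>z. f (g z))"
    and "convex_on UNIV F"
    and "is_arg_min F (\<lambda>z. z \<in> X) xstar"
    and "0 < Dx" and "\<And>z. z \<in> X \<Longrightarrow> (norm (z - xstar))\<^sup>2 \<le> Dx"
    and "a \<in> {0<..<1}" and "b \<in> {0<..<1}"
    and "\<alpha> 0 \<in> {0<..1}" and "\<And>k. k \<ge> 1 \<Longrightarrow> \<alpha> k = real k powr (- a)"
    and "\<beta> 0 \<in> {0<..1}" and "\<And>k. k \<ge> 1 \<Longrightarrow> \<beta> k = real k powr (- b)"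
    and "x0 \<in> X"
    and "scgd_iterates M w v X fv gw dg \<alpha> \<beta> x0 y0 x y"
    and "0 < Dy"
    and "\<And>k. (\<integral>\<^sup>+\<omega>. ennreal ((norm (y (Suc k) \<omega> - g (x k \<omega>)))\<^sup>2) \<partial>M) \<le> ennreal Dy"
  shows
    "(\<forall>k\<ge>1. integrable M (\<lambda>\<omega>. F (averaged_iterate x k \<omega>) - F xstar)) \<and>
     is_bigO (\<lambda>k. \<integral>\<omega>. F (averaged_iterate x k \<omega>) - F xstar \<partial>M)
       (rate_bound Cg Cf Vg Lf Dx Dy a b) \<and>
     (\<forall>a'\<in>{0<..<1}. \<forall>b'\<in>{0<..<1}.
        rate_bound Cg Cf Vg Lf Dx Dy (3/4) (1/2) \<in> O(rate_bound Cg Cf Vg Lf Dx Dy a' b')) \<and>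
     (a = 3/4 \<and> b = 1/2 \<longrightarrow>
        is_bigO (\<lambda>k. \<integral>\<omega>. F (averaged_iterate x k \<omega>) - F xstar \<partial>M)
          (\<lambda>k. ((1 + Lf\<^sup>2 * Cg\<^sup>2) * (Dx + Dy) + Vg + Cg\<^sup>2 * Cf) / real k powr (1/4)
                + Cf * Cg / real k powr (3/4)))"
proof -
  interpret scgd_setting M MW MV w v X f g fv gw dg Cg Cf Vg Lf by fact
  have \<alpha>_bounds: "0 < \<alpha> k \<and> \<alpha> k \<le> 1" for k
    using assms(7,9) assms(10)[of k] by (cases "k = 0") (auto simp: powr_minus_divide ge_one_powr_ge_zero)
  have \<beta>_bounds: "0 < \<beta> k \<and> \<beta> k \<le> 1" for k
    using assms(8,11) assms(12)[of k] by (cases "k = 0") (auto simp: powr_minus_divide ge_one_powr_ge_zero)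
  interpret scgd_run M MW MV w v X f g fv gw dg Cg Cf Vg Lf \<alpha> \<beta> x0 y0 x y xstar Dx Dy
  proof
    show "xstar \<in> X" "\<And>u. u \<in> X \<Longrightarrow> f (g xstar) \<le> f (g u)"
      using assms(4) unfolding is_arg_min_linorder assms(2) by auto
  qed (use assms \<alpha>_bounds \<beta>_bounds in auto)
  let ?E = "\<lambda>k. \<integral>\<omega>. F (averaged_iterate x k \<omega>) - F xstar \<partial>M"
  have rate: "is_bigO ?E (rate_bound Cg Cf Vg Lf Dx Dy a b)"
    using averaged_gap_rate[of a b] \<alpha>_bounds assms unfolding assms(2) by auto
  have "is_bigO ?E (\<lambda>k. ((1 + Lf\<^sup>2 * Cg\<^sup>2) * (Dx + Dy) + Vg + Cg\<^sup>2 * Cf) / real k powr (1/4)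
      + Cf * Cg / real k powr (3/4))" (is "is_bigO ?E ?h") if ab: "a = 3/4 \<and> b = 1/2"
  proof -
    obtain c where c: "0 < c" "\<And>k. k \<ge> 1 \<Longrightarrow> \<bar>?E k\<bar> \<le> c * \<bar>rate_bound Cg Cf Vg Lf Dx Dy (3/4) (1/2) k\<bar>"
      using rate ab unfolding is_bigO_def by blast
    \<comment> \<open>The extra 2 absorbs the doubled coefficient of
      \<open>rate_bound_optimal_eq\<close>, which occurs only once in \<open>?h\<close>.\<close>
    have "\<bar>?E k\<bar> \<le> c * 2 * \<bar>?h k\<bar>" if "k \<ge> 1" for k
    proof -
      let ?p = "(1 + Lf\<^sup>2 * Cg\<^sup>2) * (Dx + Dy)"
      have p: "0 \<le> ?p" using assms(5,15) by simp
      have r: "0 \<le> rate_bound Cg Cf Vg Lf Dx Dy (3/4) (1/2) k"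
        using p consts_pos unfolding rate_bound_optimal_eq by (intro add_nonneg_nonneg divide_nonneg_nonneg) auto
      have "rate_bound Cg Cf Vg Lf Dx Dy (3/4) (1/2) k
          \<le> (2 * (?p + Vg + Cg\<^sup>2 * Cf)) / real k powr (1/4) + 2 * (Cf * Cg) / real k powr (3/4)"
        using p consts_pos unfolding rate_bound_optimal_eq by (intro add_mono divide_right_mono) auto
      also have "\<dots> = 2 * ?h k" by simp
      finally have "\<bar>rate_bound Cg Cf Vg Lf Dx Dy (3/4) (1/2) k\<bar> \<le> 2 * \<bar>?h k\<bar>"
        unfolding abs_of_nonneg[OF r] by (rule order_trans) (intro mult_left_mono abs_ge_self, simp)
      then have "c * \<bar>rate_bound Cg Cf Vg Lf Dx Dy (3/4) (1/2) k\<bar> \<le> c * (2 * \<bar>?h k\<bar>)"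
        using c(1) by (intro mult_left_mono) auto
      then show ?thesis using c(2)[OF that] by (simp add: mult.assoc)
    qed
    then show ?thesis unfolding is_bigO_def using c(1) by (intro exI[of _ "c * 2"]) auto
  qed
  moreover have "integrable M (\<lambda>\<omega>. F (averaged_iterate x k \<omega>) - F xstar)" if "k \<ge> 1" for k
    using averaged_gap_integrable[OF that] unfolding assms(2) .
  ultimately show ?thesis
    using rate rate_bound_optimal consts_pos assms(5,15) by blast
qed

end
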